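(* Let $(X,R)$ be a circularly ordered set and let $(\mathcal X_r,\mathcal R)$ be its Novák regular completion. Let $\lambda_R$ be the interval topology of $(X,R)$ and $\mathrm{int}_r$ the interval topology of the circularly ordered set $(\mathcal X_r,\mathcal R)$. Then the canonical map $$\nu:(X,\lambda_R)\to(\mathcal X_r,\mathrm{int}_r),\qquad x\mapsto\ \leq_x,$$ is a COP topological embedding, and $\nu(X)$ is dense in $(\mathcal X_r,\mathrm{int}_r)$, which is a compact circularly ordered topological space.
   Context: A circular order on a set $X$ is a ternary relation $R\subseteq X^3$ (write $[a,b,c]$ for $(a,b,c)\in R$) satisfying: cyclicity ($[a,b,c]\Rightarrow[b,c,a]$); asymmetry ($[a,b,c]\Rightarrow (c,b,a)\notin R$); transitivity ($[a,b,c]$ and $[a,c,d]$ imply $[a,b,d]$); totality (if $a,b,c$ are distinct then $[a,b,c]$ or $[a,c,b]$). Put $(a,b)_R:=\{x\in X:[a,x,b]\}$ and $[a,b]_R:=(a,b)_R\cup\{a,b\}$. The interval topology $\lambda_R$ is the topology on $X$ with base $\{X\setminus[a,b]_R: a,b\in X\}\cup\{X\}$. A map $f:X_1\to X_2$ of circularly ordered sets is COP if: (COP1) whenever $[a,b,c]$ in $X_1$ and $f(a),f(b),f(c)$ are pairwise distinct, then $[f(a),f(b),f(c)]$ in $X_2$; (COP2) if $f(x)=f(y)$ then $f$ is constant on one of the closed intervals $[x,y]$, $[y,x]$. Novák's regular completion. A cut on $(X,R)$ is a linear order $\leq$ on the set $X$ such that $a<b<c$ implies $[a,b,c]$. A gap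 is a cut having neither a least nor a greatest element. For $x\in X$ the lower point-cut $\leq_x$ is the linear order with least element $x$ and $a<_x b\iff[x,a,b]$ for $a,b\neq x$. A regular cut is either a gap or a lower point-cut $\leq_x$, $x\in X$; $\mathcal X_r$ is the set of all regular cuts. For distinct $L_1,L_2,L_3\in\mathcal X_r$ put $[L_1,L_2,L_3]_{\mathcal R}$ iff there is a partition $X=A\sqcup B\sqcup D$ into nonempty pieces such that $(X,L_1)=A\oplus B\oplus D$, $(X,L_2)=B\oplus D\oplus A$, $(X,L_3)=D\oplus A\oplus B$, where $\oplus$ denotes the ordinal sum of linearly ordered sets (the same order on each piece being used in all three sums). It is known (Novák) that $\mathcal R$ is a circular order on $\mathcal X_r$, that $(\mathcal X_r,\mathcal R)$ has no gaps, and that for distinct $a,b,c\in X$: $[a,b,c]_R\iff[\leq_a,\leq_b,\leq_c]_{\mathcal R}$. It is also known that the interval topology of a circular order is compact iff the circular order has no gaps. *)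

theory Defs
  imports "HOL-Analysis.Analysis"
begin

section \<open>Circular orders\<close>

definition circular_order_on :: "'a set \<Rightarrow> ('a \<times> 'a \<times> 'a) set \<Rightarrow> bool" where
  "circular_order_on X R \<longleftrightarrow>
     R \<subseteq> X \<times> X \<times> X \<and>
     (\<forall>a b c. (a, b, c) \<in> R \<longrightarrow> (b, c, a) \<in> R) \<and>
     (\<forall>a b c. (a, b, c) \<in> R \<longrightarrow> (c, b, a) \<notin> R) \<and>
     (\<forall>a b c d. (a, b, c) \<in> R \<and> (a, c, d) \<in> R \<longrightarrow> (a, b, d) \<in> R) \<and>
     (\<forall>a\<in>X. \<forall>b\<in>X. \<forall>c\<in>X. a \<noteq> b \<and> b \<noteq> c \<and> a \<noteq> c \<longrightarrow> (a, b, c) \<in> R \<or> (a, c, b) \<in> R)"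

definition open_arc :: "'a set \<Rightarrow> ('a \<times> 'a \<times> 'a) set \<Rightarrow> 'a \<Rightarrow> 'a \<Rightarrow> 'a set" where
  "open_arc X R a b = {x \<in> X. (a, x, b) \<in> R}"

definition closed_arc :: "'a set \<Rightarrow> ('a \<times> 'a \<times> 'a) set \<Rightarrow> 'a \<Rightarrow> 'a \<Rightarrow> 'a set" where
  "closed_arc X R a b = open_arc X R a b \<union> {a, b}"

definition interval_base :: "'a set \<Rightarrow> ('a \<times> 'a \<times> 'a) set \<Rightarrow> 'a set set" where
  "interval_base X R = {X - closed_arc X R a b | a b. a \<in> X \<and> b \<in> X} \<union> {X}"

text \<open>
  The generating family of \<^const>\<open>topology_generated_by\<close> is in general only a subbase;
  lemma \<open>openin_interval_topology\<close> below shows that here it is a base.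
\<close>

definition interval_topology :: "'a set \<Rightarrow> ('a \<times> 'a \<times> 'a) set \<Rightarrow> 'a topology" where
  "interval_topology X R = topology_generated_by (interval_base X R)"

definition cop ::
  "'a set \<Rightarrow> ('a \<times> 'a \<times> 'a) set \<Rightarrow> 'b set \<Rightarrow> ('b \<times> 'b \<times> 'b) set \<Rightarrow> ('a \<Rightarrow> 'b) \<Rightarrow> bool"
where
  "cop X1 R1 X2 R2 f \<longleftrightarrow>
     f ` X1 \<subseteq> X2 \<and>
     (\<forall>a b c. (a, b, c) \<in> R1 \<and> f a \<noteq> f b \<and> f b \<noteq> f c \<and> f a \<noteq> f c \<longrightarrow> (f a, f b, f c) \<in> R2) \<and>
     (\<forall>x\<in>X1. \<forall>y\<in>X1. f x = f y \<longrightarrow>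
        f constant_on closed_arc X1 R1 x y \<or> f constant_on closed_arc X1 R1 y x)"

lemma circular_order_onD:
  assumes "circular_order_on X R"
  shows "(u, v, w) \<in> R \<Longrightarrow> (v, w, u) \<in> R"
    and "(u, v, w) \<in> R \<Longrightarrow> (w, v, u) \<notin> R"
    and "(u, v, w) \<in> R \<Longrightarrow> (u, w, z) \<in> R \<Longrightarrow> (u, v, z) \<in> R"
    and "u \<in> X \<Longrightarrow> v \<in> X \<Longrightarrow> w \<in> X \<Longrightarrow> u \<noteq> v \<Longrightarrow> v \<noteq> w \<Longrightarrow> u \<noteq> w \<Longrightarrow>
      (u, v, w) \<in> R \<or> (u, w, v) \<in> R"
  using assms unfolding circular_order_on_def by - (elim conjE; metis)+

lemma closed_arc_from_outside:
  assumes R: "circular_order_on X R" and "x \<in> X" "a \<in> X" "b \<in> X" "x \<notin> closed_arc X R a b"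
  shows "a = b \<or> (x, a, b) \<in> R"
    and "closed_arc X R a b =
      {y \<in> X. y \<noteq> x \<and> (y = a \<or> (x, a, y) \<in> R) \<and> (y = b \<or> (x, y, b) \<in> R)}" (is "_ = ?S")
proof -
  note cyc = circular_order_onD(1)[OF R] and asym = circular_order_onD(2)[OF R]
    and trans = circular_order_onD(3)[OF R] and total = circular_order_onD(4)[OF R]
  have ne: "x \<noteq> a" "x \<noteq> b" "(a, x, b) \<notin> R"
    using assms unfolding closed_arc_def open_arc_def by auto
  show ab: "a = b \<or> (x, a, b) \<in> R"
    using total[of a x b] ne assms(2-4) cyc by metis
  show "closed_arc X R a b = ?S"
  proof (intro set_eqI iffI)
    fix y assume y: "y \<in> closed_arc X R a b"
    then have yX: "y \<in> X" and yx: "y \<noteq> x" using assms unfolding closed_arc_def open_arc_def by auto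
    consider "y = a" | "y = b" | "(a, y, b) \<in> R"
      using y unfolding closed_arc_def open_arc_def by auto
    then show "y \<in> ?S"
    proof cases
      case 3
      then have "(x, a, b) \<in> R" using ab cyc asym by metis
      then have "(x, a, y) \<in> R" "(x, y, b) \<in> R" using 3 cyc trans by metis+
      then show ?thesis using yX yx by simp
    qed (use ab yX yx in auto)
  next
    fix y assume y: "y \<in> ?S"
    show "y \<in> closed_arc X R a b"
    proof (cases "y = a \<or> y = b")
      case False
      then have xay: "(x, a, y) \<in> R" and xyb: "(x, y, b) \<in> R" using y by auto
      have "(y, x, a) \<in> R" by (rule cyc[OF cyc[OF xay]])
      then have "(y, b, a) \<in> R" by (rule trans[OF cyc[OF xyb]])
      then have "(a, y, b) \<in> R" by (rule cyc[OF cyc])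
      then show ?thesis using y unfolding closed_arc_def open_arc_def by auto
    qed (auto simp: closed_arc_def)
  qed
qed

lemma interval_base_Int:
  assumes R: "circular_order_on X R" and U: "U \<in> interval_base X R" and V: "V \<in> interval_base X R"
    and x: "x \<in> U \<inter> V"
  shows "\<exists>W \<in> interval_base X R. x \<in> W \<and> W \<subseteq> U \<inter> V"
proof (cases "U = X \<or> V = X")
  case True
  have "U \<subseteq> X" "V \<subseteq> X" using U V unfolding interval_base_def by auto
  then show ?thesis using True U V x by (metis Int_absorb1 Int_absorb2 order_refl)
next
  case False
  then obtain a b c d where X: "a \<in> X" "b \<in> X" "c \<in> X" "d \<in> X"
    and U': "U = X - closed_arc X R a b" and V': "V = X - closed_arc X R c d"
    using U V unfolding interval_base_def by auto
  define le where "le u v \<longleftrightarrow> u = v \<or> (x, u, v) \<in> R" for u v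
  have xX: "x \<in> X" "x \<notin> closed_arc X R a b" "x \<notin> closed_arc X R c d" using x U' V' by auto
  then have ne: "x \<noteq> a" "x \<noteq> b" "x \<noteq> c" "x \<noteq> d" unfolding closed_arc_def by auto
  have tr: "le u w" if "le u v" "le v w" for u v w
    using circular_order_onD(3)[OF R] that unfolding le_def by metis
  have tot: "le u v \<or> le v u" if "u \<in> X" "v \<in> X" "u \<noteq> x" "v \<noteq> x" for u v
    using circular_order_onD(4)[OF R, of x u v] that xX(1) unfolding le_def by metis
  have ab: "le a b" and ab': "closed_arc X R a b = {y \<in> X. y \<noteq> x \<and> le a y \<and> le y b}"
    using closed_arc_from_outside[OF R xX(1) X(1,2) xX(2)] unfolding le_def by auto
  have cd: "le c d" and cd': "closed_arc X R c d = {y \<in> X. y \<noteq> x \<and> le c y \<and> le y d}"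
    using closed_arc_from_outside[OF R xX(1) X(3,4) xX(3)] unfolding le_def by auto
  obtain e where e: "e \<in> X" "e \<noteq> x" "le e a" "le e c"
    using tot[of a c] X ne le_def by metis
  obtain f where f: "f \<in> X" "f \<noteq> x" "le b f" "le d f"
    using tot[of b d] X ne le_def by metis
  have ef: "le e f" using e f ab tr by blast
  have nx: "x \<notin> closed_arc X R e f"
  proof
    assume "x \<in> closed_arc X R e f"
    then have "(e, x, f) \<in> R" using e f unfolding closed_arc_def open_arc_def by auto
    then show False
      using ef circular_order_onD(1,2)[OF R] unfolding le_def by metis
  qed
  have ef': "closed_arc X R e f = {y \<in> X. y \<noteq> x \<and> le e y \<and> le y f}"
    using closed_arc_from_outside[OF R xX(1) e(1) f(1) nx] unfolding le_def by auto
  have "X - closed_arc X R e f \<in> interval_base X R"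
    using e f unfolding interval_base_def by blast
  moreover have "X - closed_arc X R e f \<subseteq> U \<inter> V"
    unfolding U' V' ab' cd' ef' using e f tr by blast
  ultimately show ?thesis using nx xX by blast
qed

lemma openin_interval_topology:
  assumes R: "circular_order_on X R"
  shows "openin (interval_topology X R) U \<longleftrightarrow> (\<exists>\<B> \<subseteq> interval_base X R. U = \<Union>\<B>)"
proof
  assume "openin (interval_topology X R) U"
  then have "generate_topology_on (interval_base X R) U"
    unfolding interval_topology_def by (rule openin_topology_generated_by)
  then have "\<forall>x\<in>U. \<exists>W \<in> interval_base X R. x \<in> W \<and> W \<subseteq> U"
  proof induction
    case Empty
    show ?case by simp
  next
    case (Int U V)
    show ?case
    proof
      fix x assume x: "x \<in> U \<inter> V"
      obtain W1 where W1: "W1 \<in> interval_base X R" "x \<in> W1" "W1 \<subseteq> U"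
        using Int.IH(1) x by auto
      obtain W2 where W2: "W2 \<in> interval_base X R" "x \<in> W2" "W2 \<subseteq> V"
        using Int.IH(2) x by auto
      obtain W where "W \<in> interval_base X R" "x \<in> W" "W \<subseteq> W1 \<inter> W2"
        using interval_base_Int[OF R W1(1) W2(1) IntI[OF W1(2) W2(2)]] by blast
      then show "\<exists>W \<in> interval_base X R. x \<in> W \<and> W \<subseteq> U \<inter> V"
        using W1(3) W2(3) by (intro bexI[of _ W]) auto
    qed
  next
    case (UN K)
    show ?case
    proof
      fix x assume "x \<in> \<Union>K"
      then obtain k where k: "k \<in> K" "x \<in> k" by auto
      then obtain W where "W \<in> interval_base X R" "x \<in> W" "W \<subseteq> k"
        using UN.IH by meson
      then show "\<exists>W \<in> interval_base X R. x \<in> W \<and> W \<subseteq> \<Union>K"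
        using k by (intro bexI[of _ W]) auto
    qed
  next
    case (Basis s)
    then show ?case by auto
  qed
  then have "U = \<Union>{W \<in> interval_base X R. W \<subseteq> U}" by blast
  then show "\<exists>\<B> \<subseteq> interval_base X R. U = \<Union>\<B>"
    by (intro exI[of _ "{W \<in> interval_base X R. W \<subseteq> U}"]) auto
next
  assume "\<exists>\<B> \<subseteq> interval_base X R. U = \<Union>\<B>"
  then obtain \<B> where B: "\<B> \<subseteq> interval_base X R" "U = \<Union>\<B>" by auto
  show "openin (interval_topology X R) U"
    unfolding interval_topology_def B(2)
    using B(1) by (intro openin_Union topology_generated_by_Basis) auto
qed

section \<open>Novak's regular completion\<close>

definition is_cut :: "'a set \<Rightarrow> ('a \<times> 'a \<times> 'a) set \<Rightarrow> 'a rel \<Rightarrow> bool" where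
  "is_cut X R L \<longleftrightarrow>
     linear_order_on X L \<and>
     (\<forall>a b c. (a, b) \<in> L \<and> a \<noteq> b \<and> (b, c) \<in> L \<and> b \<noteq> c \<longrightarrow> (a, b, c) \<in> R)"

definition is_gap :: "'a set \<Rightarrow> ('a \<times> 'a \<times> 'a) set \<Rightarrow> 'a rel \<Rightarrow> bool" where
  "is_gap X R L \<longleftrightarrow>
     is_cut X R L \<and>
     \<not> (\<exists>m\<in>X. \<forall>x\<in>X. (m, x) \<in> L) \<and>
     \<not> (\<exists>m\<in>X. \<forall>x\<in>X. (x, m) \<in> L)"

definition lower_point_cut :: "'a set \<Rightarrow> ('a \<times> 'a \<times> 'a) set \<Rightarrow> 'a \<Rightarrow> 'a rel" where
  "lower_point_cut X R x =
     {(x, b) | b. b \<in> X} \<union>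
     {(a, b). a \<in> X - {x} \<and> b \<in> X - {x} \<and> (a = b \<or> (x, a, b) \<in> R)}"

definition regular_cuts :: "'a set \<Rightarrow> ('a \<times> 'a \<times> 'a) set \<Rightarrow> 'a rel set" where
  "regular_cuts X R = {L. is_gap X R L} \<union> lower_point_cut X R ` X"

text \<open>The ordinal sum of two linearly ordered sets, each given as a pair of carrier and order.\<close>

fun ordinal_sum :: "'a set \<times> 'a rel \<Rightarrow> 'a set \<times> 'a rel \<Rightarrow> 'a set \<times> 'a rel" where
  "ordinal_sum (A, P) (B, Q) = (A \<union> B, P \<union> Q \<union> A \<times> B)"

definition regular_circ ::
  "'a set \<Rightarrow> ('a \<times> 'a \<times> 'a) set \<Rightarrow> ('a rel \<times> 'a rel \<times> 'a rel) set"
where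
  "regular_circ X R = {(L1, L2, L3).
     L1 \<in> regular_cuts X R \<and> L2 \<in> regular_cuts X R \<and> L3 \<in> regular_cuts X R \<and>
     L1 \<noteq> L2 \<and> L2 \<noteq> L3 \<and> L1 \<noteq> L3 \<and>
     (\<exists>A B D P Q S.
        A \<noteq> {} \<and> B \<noteq> {} \<and> D \<noteq> {} \<and>
        A \<inter> B = {} \<and> B \<inter> D = {} \<and> A \<inter> D = {} \<and> A \<union> B \<union> D = X \<and>
        linear_order_on A P \<and> linear_order_on B Q \<and> linear_order_on D S \<and>
        (X, L1) = ordinal_sum (ordinal_sum (A, P) (B, Q)) (D, S) \<and>
        (X, L2) = ordinal_sum (ordinal_sum (B, Q) (D, S)) (A, P) \<and>
        (X, L3) = ordinal_sum (ordinal_sum (D, S) (A, P)) (B, Q))}"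

end

theory Submission
  imports Defs
begin

text \<open>
  Fix a base point \<open>x0\<close> and unroll the circle into the linear order \<open>u \<sqsubset> v\<close> with least element
  \<open>x0\<close>. A cut \<open>L\<close> is then determined by the initial segment \<open>code L\<close> of the points lying after \<open>x0\<close>
  in \<open>L\<close>: it is the sum \<open>(X - code L) \<oplus> code L\<close>. Under this coding the circular order of the regular
  cuts becomes the cyclic order induced by strict inclusion. The codes are closed under nonempty
  unions (a union with a greatest point is attained, and any other union is again regular) and have
  a greatest element \<open>X\<close>, so compactness follows by the usual supremum argument. Since a gap has
  neither a least nor a greatest element, there is a point of \<open>X\<close> strictly between a gap and any
  other regular cut, on either side; this yields both density and the embedding property.
\<close>

section \<open>Circular orders induced by linear orders\<close>

lemma topspace_interval_topology [simp]: "topspace (interval_topology X R) = X"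
  unfolding interval_topology_def topology_generated_by_topspace
  by (auto simp: interval_base_def)

text \<open>Because the generating family is a base, openness can be tested by one arc per point.
  The disjunct \<open>U = X\<close> accounts for the extra base member: in a one-point space no
  closed arc misses the point.\<close>

lemma openin_interval_topology_pointwise:
  assumes "circular_order_on X R"
  shows "openin (interval_topology X R) U \<longleftrightarrow> U \<subseteq> X \<and>
    (\<forall>x\<in>U. U = X \<or> (\<exists>a\<in>X. \<exists>b\<in>X. x \<notin> closed_arc X R a b \<and> X - closed_arc X R a b \<subseteq> U))"
    (is "_ \<longleftrightarrow> ?rhs")
proof
  assume "openin (interval_topology X R) U"
  then obtain \<B> where \<B>: "\<B> \<subseteq> interval_base X R" "U = \<Union>\<B>"
    using openin_interval_topology[OF assms] by blast
  have "U \<subseteq> X" using \<B> by (auto simp: interval_base_def)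
  moreover have "U = X \<or> (\<exists>a\<in>X. \<exists>b\<in>X. x \<notin> closed_arc X R a b \<and> X - closed_arc X R a b \<subseteq> U)"
    if x: "x \<in> U" for x
  proof -
    obtain W where W: "W \<in> \<B>" "x \<in> W" using x unfolding \<B>(2) by blast
    have "W \<subseteq> U" using W \<B> by auto
    show ?thesis
    proof (cases "W = X")
      case True
      then show ?thesis using \<open>W \<subseteq> U\<close> \<open>U \<subseteq> X\<close> by blast
    next
      case False
      then obtain a b where "a \<in> X" "b \<in> X" "W = X - closed_arc X R a b"
        using W(1) \<B>(1) unfolding interval_base_def by blast
      then show ?thesis using W \<open>W \<subseteq> U\<close> by blast
    qed
  qed
  ultimately show ?rhs by blast
next
  assume r: ?rhs
  show "openin (interval_topology X R) U"
  proof (cases "U = X")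
    case True
    then show ?thesis by (metis openin_topspace topspace_interval_topology)
  next
    case False
    have "\<exists>T. openin (interval_topology X R) T \<and> x \<in> T \<and> T \<subseteq> U" if x: "x \<in> U" for x
    proof -
      obtain a b where "a \<in> X" "b \<in> X" "x \<notin> closed_arc X R a b" "X - closed_arc X R a b \<subseteq> U"
        using r x False by blast
      moreover from this have "openin (interval_topology X R) (X - closed_arc X R a b)"
        unfolding interval_topology_def
        by (intro topology_generated_by_Basis) (auto simp: interval_base_def)
      ultimately show ?thesis using r x by (intro exI[of _ "X - closed_arc X R a b"]) auto
    qed
    then show ?thesis by (subst openin_subopen) blast
  qed
qed

text \<open>Cutting the circle at \<open>g\<close> turns an arc that avoids \<open>g\<close> into an
  interval of a linear order, so its ends can be moved outwards without reaching \<open>g\<close>.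
  This later allows the ends of an arc in the completion to be replaced by point cuts.\<close>

lemma closed_arc_mono_outside:
  assumes C: "circular_order_on Y C" and Y: "g \<in> Y" "p \<in> Y" "q \<in> Y" "a \<in> Y" "b \<in> Y"
    and g: "g \<notin> closed_arc Y C p q"
    and ap: "a = p \<or> (g, a, p) \<in> C" and qb: "b = q \<or> (g, q, b) \<in> C"
  shows "g \<notin> closed_arc Y C a b" "closed_arc Y C p q \<subseteq> closed_arc Y C a b"
proof -
  note cyc = circular_order_onD(1)[OF C] and asym = circular_order_onD(2)[OF C]
    and trans = circular_order_onD(3)[OF C]
  define le where "le u v \<longleftrightarrow> u = v \<or> (g, u, v) \<in> C" for u v
  have tr: "le u w" if "le u v" "le v w" for u v w
    using that trans unfolding le_def by blast
  have ne: "(g, u, v) \<in> C \<Longrightarrow> g \<noteq> u \<and> g \<noteq> v" for u v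
    using cyc[of g u v] asym[of g u v] asym[of u v g] by auto
  have "le p q" and pq: "closed_arc Y C p q = {y \<in> Y. y \<noteq> g \<and> le p y \<and> le y q}"
    using closed_arc_from_outside[OF C Y(1-3) g] unfolding le_def by auto
  moreover have ap': "le a p" and qb': "le q b" using ap qb unfolding le_def by auto
  ultimately have "le a b" using tr by blast
  have "g \<noteq> p" "g \<noteq> q" using g by (auto simp: closed_arc_def)
  then have "g \<noteq> a" "g \<noteq> b" using ap qb ne by blast+
  moreover have "(a, g, b) \<notin> C"
    using \<open>le a b\<close> cyc[of a g b] asym[of g b a] cyc[of a b g] asym[of a g b] cyc[of g a b] \<open>g \<noteq> a\<close>
    unfolding le_def by auto
  ultimately show ab: "g \<notin> closed_arc Y C a b" by (auto simp: closed_arc_def open_arc_def)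
  have "closed_arc Y C a b = {y \<in> Y. y \<noteq> g \<and> le a y \<and> le y b}"
    using closed_arc_from_outside[OF C Y(1,4,5) ab] unfolding le_def by auto
  then show "closed_arc Y C p q \<subseteq> closed_arc Y C a b"
    unfolding pq using tr ap' qb' by blast
qed

text \<open>This setting is used for two circles: \<open>X\<close> unrolled at a base point, and the
  regular cuts compared by their codes. Totality is asked only on \<open>Y\<close>, since relations
  outside the carrier may share a code.\<close>

locale unrolled_circular_order =
  fixes Y :: "'b set" and C :: "('b \<times> 'b \<times> 'b) set" and lt :: "'b \<Rightarrow> 'b \<Rightarrow> bool" (infix \<open>\<sqsubset>\<close> 50)
  assumes irrefl: "\<not> p \<sqsubset> p"
    and trans: "p \<sqsubset> q \<Longrightarrow> q \<sqsubset> r \<Longrightarrow> p \<sqsubset> r"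
    and total: "p \<in> Y \<Longrightarrow> q \<in> Y \<Longrightarrow> p = q \<or> p \<sqsubset> q \<or> q \<sqsubset> p"
    and mem_C: "(p, q, r) \<in> C \<longleftrightarrow> p \<in> Y \<and> q \<in> Y \<and> r \<in> Y \<and>
      (p \<sqsubset> q \<and> q \<sqsubset> r \<or> q \<sqsubset> r \<and> r \<sqsubset> p \<or> r \<sqsubset> p \<and> p \<sqsubset> q)"
begin

lemma asym: "p \<sqsubset> q \<Longrightarrow> \<not> q \<sqsubset> p"
  using irrefl trans by blast

lemma circular_order: "circular_order_on Y C"
proof -
  have "(a, b, c) \<in> C \<or> (a, c, b) \<in> C"
    if "a \<in> Y" "b \<in> Y" "c \<in> Y" "a \<noteq> b" "b \<noteq> c" "a \<noteq> c" for a b c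
    using total[of a b] total[of b c] total[of a c] that unfolding mem_C by blast
  moreover have "C \<subseteq> Y \<times> Y \<times> Y" using mem_C by auto
  moreover have "(b, c, a) \<in> C" if "(a, b, c) \<in> C" for a b c
    using that unfolding mem_C by blast
  moreover have "(c, b, a) \<notin> C" if "(a, b, c) \<in> C" for a b c
    using that asym[of a b] asym[of b c] asym[of c a] unfolding mem_C by blast
  moreover have "(a, b, d) \<in> C" if "(a, b, c) \<in> C" "(a, c, d) \<in> C" for a b c d
    using that trans[of a b c] trans[of b c d] trans[of c d a] asym[of a c] unfolding mem_C by blast
  ultimately show ?thesis unfolding circular_order_on_def by blast
qed

text \<open>If \<open>b \<sqsubset> a\<close>, the arc runs past the end of the linear order and
  re-enters at its start, so the two conditions are joined by a disjunction. Negated strict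
  comparisons serve as weak ones and thus include the end points.\<close>

lemma closed_arc_iff:
  assumes "a \<in> Y" "b \<in> Y"
  shows "y \<in> closed_arc Y C a b \<longleftrightarrow> y \<in> Y \<and>
    (if b \<sqsubset> a then \<not> y \<sqsubset> a \<or> \<not> b \<sqsubset> y else \<not> y \<sqsubset> a \<and> \<not> b \<sqsubset> y)"
proof (cases "y \<in> Y")
  case True
  have "y \<in> closed_arc Y C a b \<longleftrightarrow> y = a \<or> y = b \<or> a \<sqsubset> y \<and> y \<sqsubset> b \<or> y \<sqsubset> b \<and> b \<sqsubset> a \<or> b \<sqsubset> a \<and> a \<sqsubset> y"
    using assms True by (auto simp: closed_arc_def open_arc_def mem_C)
  moreover consider "y = a" | "y = b" "y \<noteq> a" | "y \<noteq> a" "y \<noteq> b" by blast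
  then have "y = a \<or> y = b \<or> a \<sqsubset> y \<and> y \<sqsubset> b \<or> y \<sqsubset> b \<and> b \<sqsubset> a \<or> b \<sqsubset> a \<and> a \<sqsubset> y \<longleftrightarrow>
    (if b \<sqsubset> a then \<not> y \<sqsubset> a \<or> \<not> b \<sqsubset> y else \<not> y \<sqsubset> a \<and> \<not> b \<sqsubset> y)"
  proof cases
    case 1
    then show ?thesis using irrefl by simp
  next
    case 2
    then show ?thesis using irrefl by simp
  next
    case 3
    then have "y \<sqsubset> a \<longleftrightarrow> \<not> a \<sqsubset> y" "y \<sqsubset> b \<longleftrightarrow> \<not> b \<sqsubset> y"
      using total[OF True] assms asym by blast+
    then show ?thesis using 3 by auto
  qed
  ultimately show ?thesis using True by simp
next
  case False
  then show ?thesis using assms by (auto simp: closed_arc_def open_arc_def)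
qed

section \<open>One-sided neighbourhoods and compactness\<close>

lemma not_gt_less: "p \<in> Y \<Longrightarrow> q \<in> Y \<Longrightarrow> \<not> q \<sqsubset> p \<Longrightarrow> q \<sqsubset> r \<Longrightarrow> p \<sqsubset> r"
  using total[of p q] trans by blast

lemma less_not_gt: "q \<in> Y \<Longrightarrow> r \<in> Y \<Longrightarrow> p \<sqsubset> q \<Longrightarrow> \<not> r \<sqsubset> q \<Longrightarrow> p \<sqsubset> r"
  using total[of q r] trans by blast

text \<open>Complements of arcs, read linearly: a basic neighbourhood is either an open interval
  from \<open>b\<close> to \<open>a\<close> or the union of an initial and a final ray.\<close>

lemma openin_cases:
  assumes "openin (interval_topology Y C) W" "q \<in> W"
  obtains "W = Y" | a b where "a \<in> Y" "b \<in> Y" "q \<in> Y"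
    "if b \<sqsubset> a then q \<sqsubset> a \<and> b \<sqsubset> q else q \<sqsubset> a \<or> b \<sqsubset> q"
    "\<And>y. y \<in> Y \<Longrightarrow> if b \<sqsubset> a then y \<sqsubset> a \<and> b \<sqsubset> y else y \<sqsubset> a \<or> b \<sqsubset> y \<Longrightarrow> y \<in> W"
proof (cases "W = Y")
  case False
  have q: "q \<in> Y" using assms openin_subset[OF assms(1)] by auto
  obtain a b where ab: "a \<in> Y" "b \<in> Y" "q \<notin> closed_arc Y C a b" "Y - closed_arc Y C a b \<subseteq> W"
    using assms False openin_interval_topology_pointwise[OF circular_order] by meson
  show ?thesis
  proof (rule that(2)[OF ab(1,2) q])
    show "if b \<sqsubset> a then q \<sqsubset> a \<and> b \<sqsubset> q else q \<sqsubset> a \<or> b \<sqsubset> q"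
      using q ab(3) closed_arc_iff[OF ab(1,2), of q] by (auto split: if_splits)
    show "y \<in> W" if "y \<in> Y" "if b \<sqsubset> a then y \<sqsubset> a \<and> b \<sqsubset> y else y \<sqsubset> a \<or> b \<sqsubset> y" for y
      using that ab(4) closed_arc_iff[OF ab(1,2), of y] by (auto split: if_splits)
  qed
qed (use that in blast)

text \<open>A basic neighbourhood restricts the points not above \<open>q\<close> only through its
  bound \<open>b\<close>, and only if \<open>b \<sqsubset> q\<close>. The mirror image
  \<open>openin_above\<close> uses the bound \<open>a\<close>.\<close>

lemma openin_below:
  assumes "openin (interval_topology Y C) W" "q \<in> W"
  shows "(\<forall>y\<in>Y. \<not> q \<sqsubset> y \<longrightarrow> y \<in> W) \<or> (\<exists>c\<in>Y. c \<sqsubset> q \<and> (\<forall>y\<in>Y. c \<sqsubset> y \<and> \<not> q \<sqsubset> y \<longrightarrow> y \<in> W))"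
  using assms
proof (cases rule: openin_cases)
  case (2 a b)
  have "y \<in> W" if "y \<in> Y" "\<not> q \<sqsubset> y" "b \<sqsubset> q \<Longrightarrow> b \<sqsubset> y" for y
    using that 2(4) not_gt_less[OF that(1) 2(3) that(2), of a]
    by (intro 2(5)) (auto split: if_splits)
  then show ?thesis using 2(2) by blast
qed blast

lemma openin_above:
  assumes "openin (interval_topology Y C) W" "q \<in> W"
  shows "(\<forall>y\<in>Y. \<not> y \<sqsubset> q \<longrightarrow> y \<in> W) \<or> (\<exists>d\<in>Y. q \<sqsubset> d \<and> (\<forall>y\<in>Y. \<not> y \<sqsubset> q \<and> y \<sqsubset> d \<longrightarrow> y \<in> W))"
  using assms
proof (cases rule: openin_cases)
  case (2 a b)
  have "y \<in> W" if "y \<in> Y" "\<not> y \<sqsubset> q" "q \<sqsubset> a \<Longrightarrow> y \<sqsubset> a" for y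
    using that 2(4) less_not_gt[OF 2(3) that(1) _ that(2), of b]
    by (intro 2(5)) (auto split: if_splits)
  then show ?thesis using 2(1) by blast
qed blast

text \<open>On the circle the greatest element is followed by the start of the order. Nothing lies
  above \<open>t\<close>, so the complement of an arc avoiding \<open>t\<close> cannot be an open
  interval and must contain an initial ray.\<close>

lemma openin_greatest:
  assumes "openin (interval_topology Y C) W" "t \<in> W" "\<And>y. y \<in> Y \<Longrightarrow> \<not> t \<sqsubset> y"
  shows "\<exists>c\<in>Y. \<forall>y\<in>Y. y \<sqsubset> c \<longrightarrow> y \<in> W"
  using assms(1,2)
proof (cases rule: openin_cases)
  case 1
  then show ?thesis using assms(2) by blast
next
  case (2 a b)
  then have "\<not> b \<sqsubset> a" using assms(3)[of a] by auto
  then show ?thesis using 2(1,5) by (intro bexI[of _ a]) auto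
qed

text \<open>\<open>Sup\<close> concerns non-empty sets only, and \<open>Y\<close> may lack a least
  element. The supremum argument therefore starts from a neighbourhood of the greatest element
  \<open>t\<close>, by \<open>openin_greatest\<close>.\<close>

lemma compact:
  assumes t: "t \<in> Y" "\<And>y. y \<in> Y \<Longrightarrow> \<not> t \<sqsubset> y"
    and Sup: "\<And>S. S \<subseteq> Y \<Longrightarrow> S \<noteq> {} \<Longrightarrow>
      \<exists>s\<in>Y. (\<forall>p\<in>S. \<not> s \<sqsubset> p) \<and> (\<forall>c\<in>Y. c \<sqsubset> s \<longrightarrow> (\<exists>p\<in>S. c \<sqsubset> p))"
  shows "compact_space (interval_topology Y C)"
proof -
  let ?T = "interval_topology Y C"
  have "\<exists>\<F>. finite \<F> \<and> \<F> \<subseteq> \<U> \<and> Y \<subseteq> \<Union>\<F>"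
    if op: "\<And>U. U \<in> \<U> \<Longrightarrow> openin ?T U" and cov: "Y \<subseteq> \<Union>\<U>" for \<U>
  proof -
    define fincov where "fincov K \<longleftrightarrow> (\<exists>\<F>. finite \<F> \<and> \<F> \<subseteq> \<U> \<and> K \<subseteq> \<Union>\<F>)" for K
    have add: "fincov K'" if K: "fincov K" "W \<in> \<U>" "K' \<subseteq> K \<union> W" for K K' W
    proof -
      obtain \<F> where "finite \<F>" "\<F> \<subseteq> \<U>" "K \<subseteq> \<Union>\<F>" using K(1) unfolding fincov_def by blast
      then show ?thesis using K unfolding fincov_def by (intro exI[of _ "insert W \<F>"]) auto
    qed
    have empty: "fincov {}" unfolding fincov_def by blast
    define upto where "upto p = {y \<in> Y. \<not> p \<sqsubset> y}" for p
    define S where "S = {p \<in> Y. fincov (upto p)}"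
    obtain W0 where W0: "W0 \<in> \<U>" "t \<in> W0" using cov t by blast
    obtain c0 where c0: "c0 \<in> Y" "\<forall>y\<in>Y. y \<sqsubset> c0 \<longrightarrow> y \<in> W0"
      using openin_greatest[OF op[OF W0(1)] W0(2)] t by blast
    obtain W1 where W1: "W1 \<in> \<U>" "c0 \<in> W1" using cov c0 by blast
    \<comment> \<open>This makes \<open>S\<close> non-empty: the points before \<open>c0\<close> lie
      in \<open>W0\<close>, and \<open>W1\<close> is added for \<open>c0\<close> itself.\<close>
    have "upto c0 \<subseteq> W0 \<union> W1" using c0 W1 total unfolding upto_def by blast
    moreover have "fincov W0" using add[OF empty W0(1)] by blast
    ultimately have "c0 \<in> S" using add[OF _ W1(1)] c0(1) unfolding S_def by blast
    then obtain s where s: "s \<in> Y" "\<And>p. p \<in> S \<Longrightarrow> \<not> s \<sqsubset> p"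
        "\<And>c. c \<in> Y \<Longrightarrow> c \<sqsubset> s \<Longrightarrow> \<exists>p\<in>S. c \<sqsubset> p"
      using Sup[of S] unfolding S_def by blast
    obtain W where W: "W \<in> \<U>" "s \<in> W" using cov s by blast
    \<comment> \<open>Either \<open>W\<close> covers everything up to \<open>s\<close>, or it
      reaches down to some \<open>c\<close> before \<open>s\<close>; an element of \<open>S\<close>
      beyond \<open>c\<close> then already has a finite cover.\<close>
    have "fincov (upto s)"
      using openin_below[OF op[OF W(1)] W(2)]
    proof
      assume "\<forall>y\<in>Y. \<not> s \<sqsubset> y \<longrightarrow> y \<in> W"
      then show ?thesis by (intro add[OF empty W(1)]) (auto simp: upto_def)
    next
      assume "\<exists>c\<in>Y. c \<sqsubset> s \<and> (\<forall>y\<in>Y. c \<sqsubset> y \<and> \<not> s \<sqsubset> y \<longrightarrow> y \<in> W)"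
      then obtain c where c: "c \<in> Y" "c \<sqsubset> s" "\<And>y. y \<in> Y \<Longrightarrow> c \<sqsubset> y \<Longrightarrow> \<not> s \<sqsubset> y \<Longrightarrow> y \<in> W"
        by blast
      then obtain p where p: "p \<in> S" "c \<sqsubset> p" using s by blast
      have "upto s \<subseteq> upto p \<union> W" using c p trans unfolding upto_def by blast
      then show ?thesis using add[OF _ W(1)] p unfolding S_def by blast
    qed
    \<comment> \<open>If \<open>W\<close> does not cover everything above \<open>s\<close>, its
      bound \<open>d\<close> enters \<open>S\<close>, with one more member \<open>W'\<close>
      covering \<open>d\<close> itself. This contradicts that \<open>s\<close> bounds
      \<open>S\<close>.\<close>
    have "fincov Y"
      using openin_above[OF op[OF W(1)] W(2)]
    proof
      assume "\<forall>y\<in>Y. \<not> y \<sqsubset> s \<longrightarrow> y \<in> W"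
      then have "Y \<subseteq> upto s \<union> W" using irrefl trans unfolding upto_def by blast
      then show ?thesis using add[OF \<open>fincov (upto s)\<close> W(1)] by blast
    next
      assume "\<exists>d\<in>Y. s \<sqsubset> d \<and> (\<forall>y\<in>Y. \<not> y \<sqsubset> s \<and> y \<sqsubset> d \<longrightarrow> y \<in> W)"
      then obtain d where d: "d \<in> Y" "s \<sqsubset> d" "\<And>y. y \<in> Y \<Longrightarrow> \<not> y \<sqsubset> s \<Longrightarrow> y \<sqsubset> d \<Longrightarrow> y \<in> W"
        by blast
      obtain W' where W': "W' \<in> \<U>" "d \<in> W'" using cov d by blast
      have "upto d \<subseteq> (upto s \<union> W) \<union> W'"
      proof
        fix y assume "y \<in> upto d"
        then have "y \<in> Y" "y = d \<or> y \<sqsubset> d" using total d unfolding upto_def by auto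
        then show "y \<in> (upto s \<union> W) \<union> W'" using d W' irrefl trans unfolding upto_def by blast
      qed
      moreover have "fincov (upto s \<union> W)"
        using add[OF \<open>fincov (upto s)\<close> W(1)] by blast
      ultimately have "d \<in> S" using add[OF _ W'(1)] d(1) unfolding S_def by blast
      then show ?thesis using d s by blast
    qed
    then show ?thesis unfolding fincov_def .
  qed
  then show ?thesis unfolding compact_space_alt by simp
qed

end

section \<open>Coding cuts by initial segments\<close>

lemma linear_order_on_restrict:
  assumes "linear_order_on X L" "A \<subseteq> X"
  shows "linear_order_on A (Restr L A)"
proof -
  have "refl_on X L" "trans L" "antisym L" "total_on X L" using assms(1) unfolding order_on_defs by blast+
  then have "refl_on A (Restr L A)" "trans (Restr L A)" "antisym (Restr L A)" "total_on A (Restr L A)"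
    using assms(2) antisym_Restr trans_Restr by (auto simp: refl_on_def total_on_def)
  then show ?thesis unfolding order_on_defs by blast
qed

text \<open>Renaming the blocks \<open>A\<close>, \<open>B\<close>, \<open>D\<close> to
  \<open>B\<close>, \<open>D\<close>, \<open>A\<close> permutes the three sums cyclically.\<close>

lemma regular_circ_cyclic:
  assumes "(L1, L2, L3) \<in> regular_circ X R"
  shows "(L2, L3, L1) \<in> regular_circ X R"
proof -
  obtain A B D P Q S where *: "A \<noteq> {}" "B \<noteq> {}" "D \<noteq> {}"
      "A \<inter> B = {}" "B \<inter> D = {}" "A \<inter> D = {}" "A \<union> B \<union> D = X"
      "linear_order_on A P" "linear_order_on B Q" "linear_order_on D S"
      "(X, L1) = ordinal_sum (ordinal_sum (A, P) (B, Q)) (D, S)"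
      "(X, L2) = ordinal_sum (ordinal_sum (B, Q) (D, S)) (A, P)"
      "(X, L3) = ordinal_sum (ordinal_sum (D, S) (A, P)) (B, Q)"
      "L1 \<in> regular_cuts X R" "L2 \<in> regular_cuts X R" "L3 \<in> regular_cuts X R"
      "L1 \<noteq> L2" "L2 \<noteq> L3" "L1 \<noteq> L3"
    using assms unfolding regular_circ_def by blast
  have "\<exists>A B D P Q S.
        A \<noteq> {} \<and> B \<noteq> {} \<and> D \<noteq> {} \<and>
        A \<inter> B = {} \<and> B \<inter> D = {} \<and> A \<inter> D = {} \<and> A \<union> B \<union> D = X \<and>
        linear_order_on A P \<and> linear_order_on B Q \<and> linear_order_on D S \<and>
        (X, L2) = ordinal_sum (ordinal_sum (A, P) (B, Q)) (D, S) \<and>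
        (X, L3) = ordinal_sum (ordinal_sum (B, Q) (D, S)) (A, P) \<and>
        (X, L1) = ordinal_sum (ordinal_sum (D, S) (A, P)) (B, Q)"
    by (rule exI[of _ B], rule exI[of _ D], rule exI[of _ A], rule exI[of _ Q], rule exI[of _ S],
        rule exI[of _ P]) (use * in \<open>simp add: Int_commute Un_ac\<close>)
  then show ?thesis unfolding regular_circ_def using *(14-19) by blast
qed

section \<open>Unrolling the circle at a base point\<close>

locale pointed_circular_order =
  fixes X :: "'a set" and R :: "('a \<times> 'a \<times> 'a) set" and x0 :: 'a
  assumes circular: "circular_order_on X R" and base: "x0 \<in> X"
begin

lemma R_in_carrier: "(a, b, c) \<in> R \<Longrightarrow> a \<in> X \<and> b \<in> X \<and> c \<in> X"
proof -
  have "R \<subseteq> X \<times> X \<times> X" using circular unfolding circular_order_on_def by (rule conjunct1)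
  then show "(a, b, c) \<in> R \<Longrightarrow> a \<in> X \<and> b \<in> X \<and> c \<in> X" by auto
qed

lemmas R_cyclic = circular_order_onD(1)[OF circular]
lemmas R_asym = circular_order_onD(2)[OF circular]
lemmas R_trans = circular_order_onD(3)[OF circular]
lemmas R_total = circular_order_onD(4)[OF circular]

lemma R_distinct:
  assumes "(a, b, c) \<in> R"
  shows "a \<noteq> b \<and> b \<noteq> c \<and> a \<noteq> c"
  using assms R_cyclic[OF assms] R_asym[OF assms] R_asym[OF R_cyclic[OF assms]] by auto

text \<open>The carrier conditions are built in so that irreflexivity and transitivity hold for
  arbitrary arguments, as the locale demands. The case \<open>u = x0\<close> is separate because
  triples in \<open>R\<close> have distinct entries.\<close>

definition lt :: "'a \<Rightarrow> 'a \<Rightarrow> bool" (infix \<open>\<sqsubset>\<close> 50) where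
  "u \<sqsubset> v \<longleftrightarrow> u \<in> X \<and> v \<in> X \<and> v \<noteq> x0 \<and> (u = x0 \<or> (x0, u, v) \<in> R)"

lemma lt_in_carrier: "u \<sqsubset> v \<Longrightarrow> u \<in> X \<and> v \<in> X"
  unfolding lt_def by blast

lemma lt_irrefl: "\<not> u \<sqsubset> u"
  unfolding lt_def using R_distinct by blast

lemma lt_trans: "u \<sqsubset> v \<Longrightarrow> v \<sqsubset> w \<Longrightarrow> u \<sqsubset> w"
  unfolding lt_def using R_trans by blast

lemma lt_asym: "u \<sqsubset> v \<Longrightarrow> \<not> v \<sqsubset> u"
  using lt_irrefl lt_trans by blast

lemma lt_total: "u \<in> X \<Longrightarrow> v \<in> X \<Longrightarrow> u = v \<or> u \<sqsubset> v \<or> v \<sqsubset> u"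
  unfolding lt_def using R_total[of x0 u v] base by blast

lemma base_lt: "u \<in> X \<Longrightarrow> u \<noteq> x0 \<Longrightarrow> x0 \<sqsubset> u" and not_lt_base: "\<not> u \<sqsubset> x0"
  unfolding lt_def using base by auto

lemma lt_imp_R:
  assumes "u \<sqsubset> v" "v \<sqsubset> w"
  shows "(u, v, w) \<in> R"
proof (cases "u = x0")
  case False
  then have "(x0, u, v) \<in> R" "(x0, v, w) \<in> R" using assms unfolding lt_def by auto
  \<comment> \<open>Both triples are rotated so that \<open>v\<close> comes first, where
    transitivity of \<open>R\<close> applies.\<close>
  then have "(v, w, x0) \<in> R" "(v, x0, u) \<in> R" using R_cyclic by blast+
  then show ?thesis using R_trans R_cyclic by blast
qed (use assms in \<open>auto simp: lt_def\<close>)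

sublocale unrolled: unrolled_circular_order X R lt
proof
  fix p q r
  show "(p, q, r) \<in> R \<longleftrightarrow>
      p \<in> X \<and> q \<in> X \<and> r \<in> X \<and> (p \<sqsubset> q \<and> q \<sqsubset> r \<or> q \<sqsubset> r \<and> r \<sqsubset> p \<or> r \<sqsubset> p \<and> p \<sqsubset> q)" (is "_ = ?rhs")
  proof
    assume pqr: "(p, q, r) \<in> R"
    then have X: "p \<in> X" "q \<in> X" "r \<in> X" and ne: "p \<noteq> q" "q \<noteq> r" "p \<noteq> r"
      using R_in_carrier R_distinct by blast+
    \<comment> \<open>Three of the six linear arrangements of \<open>p\<close>, \<open>q\<close>,
      \<open>r\<close> would put a reversed triple into \<open>R\<close>. Excluding them leaves the
      three cyclic rotations.\<close>
    have "(r, q, p) \<notin> R" "(q, p, r) \<notin> R" "(p, r, q) \<notin> R"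
      using R_asym[OF pqr] R_asym[OF R_cyclic[OF pqr]] R_asym[OF R_cyclic[OF R_cyclic[OF pqr]]] by blast+
    then show ?rhs
      using lt_total[OF X(1,2)] lt_total[OF X(2,3)] lt_total[OF X(1,3)] ne X
        lt_imp_R[of r q p] lt_imp_R[of q p r] lt_imp_R[of p r q] by blast
  next
    assume ?rhs
    then show "(p, q, r) \<in> R" using lt_imp_R R_cyclic by blast
  qed
qed (use lt_irrefl lt_trans lt_total in blast)+

section \<open>Initial segments and the cuts they code\<close>

definition down_set :: "'a set \<Rightarrow> bool" where
  "down_set A \<longleftrightarrow> A \<subseteq> X \<and> x0 \<in> A \<and> (\<forall>u v. v \<in> A \<and> u \<sqsubset> v \<longrightarrow> u \<in> A)"

lemma down_set_lt: "down_set A \<Longrightarrow> u \<in> A \<Longrightarrow> v \<in> X \<Longrightarrow> v \<notin> A \<Longrightarrow> u \<sqsubset> v"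
  unfolding down_set_def using lt_total by blast

lemma down_set_chain: "down_set A \<Longrightarrow> down_set B \<Longrightarrow> A \<subseteq> B \<or> B \<subseteq> A"
  unfolding down_set_def using lt_total by blast

text \<open>The cut \<open>(X - A) \<oplus> A\<close>, both pieces being ordered by \<open>\<sqsubset>\<close>.\<close>
definition rot :: "'a set \<Rightarrow> 'a rel" where
  "rot A = {(u, v). u \<in> X \<and> v \<in> X \<and> (u = v \<or> (if u \<in> A \<longleftrightarrow> v \<in> A then u \<sqsubset> v else v \<in> A))}"

lemma rot_iff: "(u, v) \<in> rot A \<longleftrightarrow>
    u \<in> X \<and> v \<in> X \<and> (u = v \<or> (if u \<in> A \<longleftrightarrow> v \<in> A then u \<sqsubset> v else v \<in> A))"
  by (simp add: rot_def)

definition code :: "'a rel \<Rightarrow> 'a set" where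
  "code L = {y \<in> X. (x0, y) \<in> L}"

lemma code_rot: "down_set A \<Longrightarrow> code (rot A) = A"
  unfolding code_def rot_def down_set_def using base base_lt by auto

lemma linear_order_rot: "linear_order_on X (rot A)"
proof -
  have "rot A \<subseteq> X \<times> X" "refl_on X (rot A)" by (auto simp: rot_def refl_on_def)
  moreover have "trans (rot A)"
    unfolding trans_def rot_def using lt_trans by (auto split: if_splits)
  moreover have "antisym (rot A)"
    unfolding antisym_def rot_def using lt_asym by (auto split: if_splits)
  moreover have "total_on X (rot A)"
    unfolding total_on_def rot_def using lt_total by auto
  ultimately show ?thesis unfolding order_on_defs by blast
qed

text \<open>Every point of \<open>A\<close> precedes every point of \<open>X - A\<close> in
  \<open>\<sqsubset>\<close>, so a chain of \<open>rot A\<close> is a cyclic shift of a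
  \<open>\<sqsubset>\<close>-chain.\<close>

lemma is_cut_rot:
  assumes "down_set A"
  shows "is_cut X R (rot A)"
proof -
  have "(a, b, c) \<in> R"
    if "(a, b) \<in> rot A" "a \<noteq> b" "(b, c) \<in> rot A" "b \<noteq> c" for a b c
    using that down_set_lt[OF assms, of b a] down_set_lt[OF assms, of c b]
      down_set_lt[OF assms, of c a] down_set_lt[OF assms, of b c]
    unfolding unrolled.mem_C rot_def by (auto split: if_splits)
  then show ?thesis unfolding is_cut_def by (intro conjI linear_order_rot allI impI) (elim conjE)
qed

lemma cutD:
  assumes "is_cut X R L"
  shows "L \<subseteq> X \<times> X" and "u \<in> X \<Longrightarrow> (u, u) \<in> L"
    and "(u, v) \<in> L \<Longrightarrow> (v, w) \<in> L \<Longrightarrow> (u, w) \<in> L"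
    and "(u, v) \<in> L \<Longrightarrow> (v, u) \<in> L \<Longrightarrow> u = v"
    and "u \<in> X \<Longrightarrow> v \<in> X \<Longrightarrow> (u, v) \<in> L \<or> (v, u) \<in> L"
    and "(u, v) \<in> L \<Longrightarrow> u \<noteq> v \<Longrightarrow> (v, w) \<in> L \<Longrightarrow> v \<noteq> w \<Longrightarrow> (u, v, w) \<in> R"
proof -
  have "L \<subseteq> X \<times> X" "refl_on X L" "trans L" "antisym L" "total_on X L"
    using assms unfolding is_cut_def order_on_defs by simp_all
  then show "L \<subseteq> X \<times> X" and "u \<in> X \<Longrightarrow> (u, u) \<in> L"
    and "(u, v) \<in> L \<Longrightarrow> (v, w) \<in> L \<Longrightarrow> (u, w) \<in> L"
    and "(u, v) \<in> L \<Longrightarrow> (v, u) \<in> L \<Longrightarrow> u = v"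
    by (auto dest: refl_onD transD antisymD)
  show "u \<in> X \<Longrightarrow> v \<in> X \<Longrightarrow> (u, v) \<in> L \<or> (v, u) \<in> L"
    using \<open>refl_on X L\<close> \<open>total_on X L\<close> by (cases "u = v") (auto dest: refl_onD simp: total_on_def)
  show "(u, v) \<in> L \<Longrightarrow> u \<noteq> v \<Longrightarrow> (v, w) \<in> L \<Longrightarrow> v \<noteq> w \<Longrightarrow> (u, v, w) \<in> R"
    using assms unfolding is_cut_def by simp
qed

text \<open>If \<open>u \<sqsubset> v\<close> with \<open>v\<close> after \<open>x0\<close> in
  \<open>L\<close> but \<open>u\<close> before it, the cut condition gives
  \<open>(u, x0, v) \<in> R\<close>, whereas unrolling gives
  \<open>(x0, u, v) \<in> R\<close>.\<close>

lemma down_set_code: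
  assumes "is_cut X R L"
  shows "down_set (code L)"
proof -
  note sub = cutD(1)[OF assms] and refl = cutD(2)[OF assms] and tr = cutD(3)[OF assms]
    and anti = cutD(4)[OF assms] and tot = cutD(5)[OF assms] and cut = cutD(6)[OF assms]
  have "u \<in> code L" if v: "v \<in> code L" and uv: "u \<sqsubset> v" for u v
  proof (rule ccontr)
    assume u: "u \<notin> code L"
    have X: "u \<in> X" using uv by (rule lt_in_carrier[THEN conjunct1])
    then have "(x0, u) \<notin> L" using u by (simp add: code_def)
    then have ux: "(u, x0) \<in> L" "u \<noteq> x0" using tot[OF X base] refl[OF base] by auto
    have "(x0, v) \<in> L" "x0 \<noteq> v" using v uv by (auto simp: code_def lt_def)
    then have "(u, x0, v) \<in> R" using cut[OF ux] by simp
    moreover have "(x0, u, v) \<in> R" using uv ux(2) by (simp add: lt_def)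
    ultimately show False using R_asym[of u x0 v] R_cyclic[of x0 u v] R_cyclic[of u v x0] by simp
  qed
  moreover have "code L \<subseteq> X" "x0 \<in> code L" using refl[OF base] base by (auto simp: code_def)
  ultimately show ?thesis unfolding down_set_def by blast
qed

text \<open>The cut condition fixes the order of \<open>L\<close> on either side of
  \<open>x0\<close>, so the code determines the cut. One inclusion suffices, because an inclusion
  between linear orders on the same set is an equality.\<close>

lemma rot_code:
  assumes "is_cut X R L"
  shows "rot (code L) = L"
proof -
  note sub = cutD(1)[OF assms] and refl = cutD(2)[OF assms] and tr = cutD(3)[OF assms]
    and anti = cutD(4)[OF assms] and tot = cutD(5)[OF assms] and cut = cutD(6)[OF assms]
  have L_rot: "(u, v) \<in> rot (code L)" if uv: "(u, v) \<in> L" for u v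
  proof (cases "u = v")
    case False
    have X: "u \<in> X" "v \<in> X" using uv sub by auto
    show ?thesis
    proof (cases "v \<in> code L")
      case v: True
      show ?thesis
      proof (cases "u \<in> code L")
        case True
        then have "v \<noteq> x0" using anti[OF uv] False by (auto simp: code_def)
        moreover have "u = x0 \<or> (x0, u, v) \<in> R"
          using True cut[of x0 u v] uv False by (auto simp: code_def)
        ultimately show ?thesis using X True v unfolding rot_def lt_def by auto
      qed (use v X in \<open>auto simp: rot_def\<close>)
    next
      case v: False
      then have vx: "(v, x0) \<in> L" "v \<noteq> x0"
        using X tot[OF X(2) base] refl[OF base] by (auto simp: code_def)
      have "u \<notin> code L" using v uv tr[of x0 u v] X by (auto simp: code_def)
      moreover have "u \<sqsubset> v"
        using X vx R_cyclic[OF R_cyclic[OF cut[OF uv False vx]]] by (simp add: lt_def)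
      ultimately have "u \<sqsubset> v" "u \<notin> code L" by simp_all
      then show ?thesis using X v \<open>u \<notin> code L\<close> unfolding rot_def by auto
    qed
  qed (use sub uv in \<open>auto simp: rot_def\<close>)
  moreover have "(u, v) \<in> L" if uv: "(u, v) \<in> rot (code L)" for u v
  proof -
    have X: "u \<in> X" "v \<in> X" using uv by (auto simp: rot_def)
    have "antisym (rot (code L))" using linear_order_rot unfolding order_on_defs by simp
    then show ?thesis using uv tot[OF X] L_rot[of v u] by (auto dest: antisymD)
  qed
  ultimately show ?thesis by auto
qed

text \<open>
  The code of the point cut at \<open>x\<close>. The base point gets the whole of \<open>X\<close> rather than the empty
  segment, so it is the greatest code although \<open>x0\<close> is the least point.
\<close>
definition seg :: "'a \<Rightarrow> 'a set" where
  "seg x = (if x = x0 then X else {y. y \<sqsubset> x})"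

lemma down_set_seg: "x \<in> X \<Longrightarrow> down_set (seg x)"
  by (auto simp: seg_def down_set_def base base_lt dest: lt_in_carrier lt_trans)

text \<open>The lower point cut starts at \<open>x\<close>, runs to the end of
  \<open>\<sqsubset>\<close> and continues with the points before \<open>x\<close>. For
  \<open>x0\<close> it is \<open>\<sqsubset>\<close> itself, and \<open>seg x0 = X\<close> leaves
  the first piece of the rotation empty.\<close>

lemma lower_point_cut_eq_rot:
  assumes "x \<in> X"
  shows "lower_point_cut X R x = rot (seg x)"
proof (cases "x = x0")
  case True
  have "(u, v) \<in> lower_point_cut X R x \<longleftrightarrow> (u, v) \<in> rot (seg x)" for u v
    unfolding lower_point_cut_def rot_def seg_def lt_def True using base by auto
  then show ?thesis by auto
next
  case False
  have "(u, v) \<in> lower_point_cut X R x \<longleftrightarrow> (u, v) \<in> rot (seg x)" for u v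
  proof (cases "u \<in> X \<and> v \<in> X")
    case X: True
    have ux: "u = x \<or> u \<sqsubset> x \<or> x \<sqsubset> u" and vx: "v = x \<or> v \<sqsubset> x \<or> x \<sqsubset> v" and uv: "u = v \<or> u \<sqsubset> v \<or> v \<sqsubset> u"
      using X assms lt_total by auto
    show ?thesis
    proof (cases "u = x \<or> v = x \<or> u = v")
      case True
      then show ?thesis
        using X assms False ux vx
        by (auto simp: lower_point_cut_def rot_def seg_def lt_irrefl dest: lt_asym)
    next
      case 2: False
      have "(x, u, v) \<in> R \<longleftrightarrow> (if u \<sqsubset> x \<longleftrightarrow> v \<sqsubset> x then u \<sqsubset> v else v \<sqsubset> x)"
        using ux vx uv 2 X assms lt_asym[of u x] lt_asym[of v x] lt_asym[of u v]
          lt_trans[of u x v] lt_trans[of v x u] unfolding unrolled.mem_C by (simp; blast)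
      then show ?thesis using 2 X assms False unfolding lower_point_cut_def rot_def seg_def by auto
    qed
  qed (use assms in \<open>auto simp: lower_point_cut_def rot_def\<close>)
  then show ?thesis by auto
qed

lemma code_lower_point_cut: "x \<in> X \<Longrightarrow> code (lower_point_cut X R x) = seg x"
  using lower_point_cut_eq_rot code_rot down_set_seg by simp

lemma is_cut_regular: "L \<in> regular_cuts X R \<Longrightarrow> is_cut X R L"
  by (auto simp: regular_cuts_def is_gap_def lower_point_cut_eq_rot is_cut_rot down_set_seg)

text \<open>A greatest element of \<open>rot A\<close> is one of \<open>A\<close>, which contains
  \<open>x0\<close>. A least element is one of \<open>X - A\<close>, except that \<open>x0\<close>
  is least when \<open>A = X\<close>.\<close>

lemma is_gap_rot_iff:
  assumes "down_set A"
  shows "is_gap X R (rot A) \<longleftrightarrow>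
    A \<noteq> X \<and> (\<forall>u\<in>X - A. \<exists>v\<in>X - A. v \<sqsubset> u) \<and> (\<forall>u\<in>A. \<exists>v\<in>A. u \<sqsubset> v)"
proof -
  have A: "A \<subseteq> X" "x0 \<in> A" using assms unfolding down_set_def by auto
  have "(\<exists>m\<in>X. \<forall>x\<in>X. (m, x) \<in> rot A) \<longleftrightarrow> A = X \<or> (\<exists>u\<in>X - A. \<forall>v\<in>X - A. \<not> v \<sqsubset> u)"
  proof
    assume "\<exists>m\<in>X. \<forall>x\<in>X. (m, x) \<in> rot A"
    then obtain m where m: "m \<in> X" "\<And>x. x \<in> X \<Longrightarrow> (m, x) \<in> rot A" by blast
    have "m \<notin> A" if ne: "A \<noteq> X"
    proof -
      obtain z where "z \<in> X" "z \<notin> A" using ne A by blast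
      then show ?thesis using m(2)[of z] by (auto simp: rot_def)
    qed
    moreover have "\<not> v \<sqsubset> m" if "m \<notin> A" "v \<in> X - A" for v
      using m(2)[of v] that by (auto simp: rot_def lt_irrefl dest: lt_asym)
    ultimately show "A = X \<or> (\<exists>u\<in>X - A. \<forall>v\<in>X - A. \<not> v \<sqsubset> u)" using m(1) by blast
  next
    assume "A = X \<or> (\<exists>u\<in>X - A. \<forall>v\<in>X - A. \<not> v \<sqsubset> u)"
    then show "\<exists>m\<in>X. \<forall>x\<in>X. (m, x) \<in> rot A"
    proof
      assume "A = X"
      then have "\<forall>x\<in>X. (x0, x) \<in> rot A" using base base_lt by (auto simp: rot_def)
      then show ?thesis using base by blast
    next
      assume "\<exists>u\<in>X - A. \<forall>v\<in>X - A. \<not> v \<sqsubset> u"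
      then obtain u where u: "u \<in> X - A" "\<forall>v\<in>X - A. \<not> v \<sqsubset> u" by blast
      then have "\<forall>x\<in>X. (u, x) \<in> rot A" using lt_total[of u] unfolding rot_def by auto
      then show ?thesis using u by blast
    qed
  qed
  moreover have "(\<exists>m\<in>X. \<forall>x\<in>X. (x, m) \<in> rot A) \<longleftrightarrow> (\<exists>u\<in>A. \<forall>v\<in>A. \<not> u \<sqsubset> v)"
  proof
    assume "\<exists>m\<in>X. \<forall>x\<in>X. (x, m) \<in> rot A"
    then obtain m where m: "m \<in> X" "\<And>x. x \<in> X \<Longrightarrow> (x, m) \<in> rot A" by blast
    have "m \<in> A" using m(2)[of x0] A base unfolding rot_def by (auto split: if_splits)
    moreover have "\<not> m \<sqsubset> v" if "v \<in> A" for v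
      using m(2)[of v] that \<open>m \<in> A\<close> A by (auto simp: rot_def lt_irrefl dest: lt_asym)
    ultimately show "\<exists>u\<in>A. \<forall>v\<in>A. \<not> u \<sqsubset> v" by blast
  next
    assume "\<exists>u\<in>A. \<forall>v\<in>A. \<not> u \<sqsubset> v"
    then obtain u where u: "u \<in> A" "\<forall>v\<in>A. \<not> u \<sqsubset> v" by blast
    then have "\<forall>x\<in>X. (x, u) \<in> rot A" using lt_total[of u] A unfolding rot_def by auto
    then show "\<exists>m\<in>X. \<forall>x\<in>X. (x, m) \<in> rot A" using u A by blast
  qed
  ultimately show ?thesis unfolding is_gap_def using is_cut_rot[OF assms] by blast
qed

text \<open>With \<open>x0\<close> in the last block \<open>D\<close> of \<open>L1\<close>, the code
  of \<open>L1\<close> is the part of \<open>D\<close> from \<open>x0\<close> on, and each rotation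
  appends another block: first \<open>A\<close>, then \<open>B\<close>. Other positions of
  \<open>x0\<close> reduce to this one by cyclic symmetry.\<close>

lemma code_psubset_of_ordinal_sums:
  assumes "A \<noteq> {}" "B \<noteq> {}" "A \<inter> B = {}" "B \<inter> D = {}" "A \<inter> D = {}" "x0 \<in> D"
    and lin: "linear_order_on A P" "linear_order_on B Q" "linear_order_on D S"
    and sums: "(X, L1) = ordinal_sum (ordinal_sum (A, P) (B, Q)) (D, S)"
      "(X, L2) = ordinal_sum (ordinal_sum (B, Q) (D, S)) (A, P)"
      "(X, L3) = ordinal_sum (ordinal_sum (D, S) (A, P)) (B, Q)"
  shows "code L1 \<subset> code L2" "code L2 \<subset> code L3"
proof -
  have PQS: "P \<subseteq> A \<times> A" "Q \<subseteq> B \<times> B" "S \<subseteq> D \<times> D"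
    using lin unfolding order_on_defs by simp_all
  have X: "X = A \<union> B \<union> D" using sums(1) by simp
  have code_alt: "code L = {y \<in> A \<union> B \<union> D. (x0, y) \<in> L}" for L
    by (simp only: code_def X[symmetric])
  define K where "K = {y. (x0, y) \<in> S}"
  have "K \<subseteq> D" using PQS unfolding K_def by blast
  have "x0 \<notin> A" "x0 \<notin> B" using assms(4-6) by blast+
  have "code L1 = K"
    using sums(1) PQS \<open>x0 \<notin> A\<close> \<open>x0 \<notin> B\<close> unfolding code_alt K_def by auto
  moreover have "code L2 = K \<union> A"
    using sums(2) PQS \<open>x0 \<notin> A\<close> \<open>x0 \<notin> B\<close> \<open>x0 \<in> D\<close> unfolding code_alt K_def by auto
  moreover have "code L3 = K \<union> A \<union> B"
    using sums(3) PQS \<open>x0 \<notin> A\<close> \<open>x0 \<notin> B\<close> \<open>x0 \<in> D\<close> unfolding code_alt K_def by auto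
  moreover have "K \<inter> A = {}" "(K \<union> A) \<inter> B = {}" using \<open>K \<subseteq> D\<close> assms(3-5) by blast+
  then have "K \<subset> K \<union> A" "K \<union> A \<subset> K \<union> A \<union> B" using assms(1,2) by blast+
  ultimately show "code L1 \<subset> code L2" "code L2 \<subset> code L3" by simp_all
qed

lemma regular_circ_of_code_psubset:
  assumes reg: "L1 \<in> regular_cuts X R" "L2 \<in> regular_cuts X R" "L3 \<in> regular_cuts X R"
    and less: "code L1 \<subset> code L2" "code L2 \<subset> code L3"
  shows "(L1, L2, L3) \<in> regular_circ X R"
proof -
  have cut: "is_cut X R L1" "is_cut X R L2" "is_cut X R L3" using is_cut_regular reg by auto
  have down: "down_set (code L1)" "down_set (code L2)" "down_set (code L3)"
    using cut down_set_code by auto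
  note rc = rot_code[OF cut(1), symmetric] rot_code[OF cut(2), symmetric] rot_code[OF cut(3), symmetric]
  define A1 A2 A3 where "A1 = code L1" and "A2 = code L2" and "A3 = code L3"
  note Ai = A1_def[symmetric] A2_def[symmetric] A3_def[symmetric]
  have L: "L1 = rot A1" "L2 = rot A2" "L3 = rot A3" using rc unfolding Ai by auto
  have sub: "A1 \<subseteq> A2" "A2 \<subseteq> A3" "A3 \<subseteq> X" "x0 \<in> A1"
    using less down unfolding down_set_def Ai by auto
  have lt: "u \<sqsubset> v" "\<not> v \<sqsubset> u" if "u \<in> A" "v \<in> X" "v \<notin> A" "A \<in> {A1, A2, A3}" for u v A
    using down_set_lt[of A u v] down that lt_asym unfolding Ai by auto
  \<comment> \<open>Along \<open>L1\<close> one meets \<open>A\<close>, \<open>B\<close>,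
    \<open>X - A3\<close> and finally \<open>A1\<close>. The last two form a single block
    \<open>D\<close> across the base point, since all three cuts put \<open>X - A3\<close>
    immediately before \<open>A1\<close>.\<close>
  define A B D where "A = A2 - A1" and "B = A3 - A2" and "D = (X - A3) \<union> A1"
  have ABD: "A \<noteq> {}" "B \<noteq> {}" "D \<noteq> {}" "A \<inter> B = {}" "B \<inter> D = {}" "A \<inter> D = {}" "A \<union> B \<union> D = X"
    using less sub unfolding A_def B_def D_def Ai by blast+
  define P Q S where "P = Restr L1 A" and "Q = Restr L1 B" and "S = Restr L1 D"
  have "linear_order_on A P" "linear_order_on B Q" "linear_order_on D S"
    unfolding P_def Q_def S_def
    by (intro linear_order_on_restrict[of X]; use cut(1) ABD in \<open>auto simp: is_cut_def\<close>)+
  moreover have "L1 = P \<union> Q \<union> A \<times> B \<union> S \<union> (A \<union> B) \<times> D"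
    "L2 = Q \<union> S \<union> B \<times> D \<union> P \<union> (B \<union> D) \<times> A"
    "L3 = S \<union> P \<union> D \<times> A \<union> Q \<union> (D \<union> A) \<times> B"
  proof -
    have reg: "u \<in> X \<longleftrightarrow> u \<in> A1 \<or> u \<in> A \<or> u \<in> B \<or> u \<in> X - A3" for u
      using sub unfolding A_def B_def by blast
    \<comment> \<open>The sums are compared with the cuts pair by pair. Membership of
      \<open>u\<close> and \<open>v\<close> in \<open>A1\<close>, \<open>A2\<close>,
      \<open>A3\<close> determines the blocks, and \<open>l\<close> and \<open>r\<close> settle
      \<open>u \<sqsubset> v\<close> whenever one of these segments separates the two
      points.\<close>
    have "((u, v) \<in> L1 \<longleftrightarrow> (u, v) \<in> P \<union> Q \<union> A \<times> B \<union> S \<union> (A \<union> B) \<times> D) \<and>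
      ((u, v) \<in> L2 \<longleftrightarrow> (u, v) \<in> Q \<union> S \<union> B \<times> D \<union> P \<union> (B \<union> D) \<times> A) \<and>
      ((u, v) \<in> L3 \<longleftrightarrow> (u, v) \<in> S \<union> P \<union> D \<times> A \<union> Q \<union> (D \<union> A) \<times> B)" for u v
    proof (cases "u \<in> X \<and> v \<in> X")
      case True
      then have X: "u \<in> X" "v \<in> X" by auto
      have s: "u \<in> A1 \<longrightarrow> u \<in> A2" "u \<in> A2 \<longrightarrow> u \<in> A3" "v \<in> A1 \<longrightarrow> v \<in> A2" "v \<in> A2 \<longrightarrow> v \<in> A3"
        using sub by auto
      have l: "u \<in> A1 \<and> v \<notin> A1 \<or> u \<in> A2 \<and> v \<notin> A2 \<or> u \<in> A3 \<and> v \<notin> A3 \<longrightarrow> u \<sqsubset> v"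
        using lt(1)[of u _ v] X by blast
      have r: "v \<in> A1 \<and> u \<notin> A1 \<or> v \<in> A2 \<and> u \<notin> A2 \<or> v \<in> A3 \<and> u \<notin> A3 \<longrightarrow> \<not> u \<sqsubset> v"
        using lt(2)[of v _ u] X by blast
      show ?thesis
      proof (cases "u = v")
        case True
        then show ?thesis
          using X(2) s(3,4) unfolding P_def Q_def S_def L A_def B_def D_def rot_def
          by (cases "v \<in> A1"; cases "v \<in> A2"; cases "v \<in> A3") simp_all
      next
        case False
        show ?thesis
          unfolding P_def Q_def S_def L A_def B_def D_def Un_iff Int_iff Diff_iff mem_Sigma_iff rot_iff
          using X False s l r
          by (cases "u \<in> A1"; cases "u \<in> A2"; cases "u \<in> A3"; cases "v \<in> A1"; cases "v \<in> A2"; cases "v \<in> A3";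
              simp only: simp_thms if_True if_False)
      qed
    next
      case False
      then show ?thesis using ABD(7) unfolding P_def Q_def S_def L rot_def by blast
    qed
    then show "L1 = P \<union> Q \<union> A \<times> B \<union> S \<union> (A \<union> B) \<times> D"
      "L2 = Q \<union> S \<union> B \<times> D \<union> P \<union> (B \<union> D) \<times> A"
      "L3 = S \<union> P \<union> D \<times> A \<union> Q \<union> (D \<union> A) \<times> B" by (intro set_eqI; simp add: split_paired_all)+
  qed
  moreover have "X = B \<union> D \<union> A" "X = D \<union> A \<union> B" using ABD(7) by blast+
  ultimately have lin: "linear_order_on A P" "linear_order_on B Q" "linear_order_on D S"
    and sums: "(X, L1) = ordinal_sum (ordinal_sum (A, P) (B, Q)) (D, S)"
      "(X, L2) = ordinal_sum (ordinal_sum (B, Q) (D, S)) (A, P)"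
      "(X, L3) = ordinal_sum (ordinal_sum (D, S) (A, P)) (B, Q)"
    using ABD(7)[symmetric] by (simp_all only: ordinal_sum.simps)
  have "\<exists>A B D P Q S.
        A \<noteq> {} \<and> B \<noteq> {} \<and> D \<noteq> {} \<and>
        A \<inter> B = {} \<and> B \<inter> D = {} \<and> A \<inter> D = {} \<and> A \<union> B \<union> D = X \<and>
        linear_order_on A P \<and> linear_order_on B Q \<and> linear_order_on D S \<and>
        (X, L1) = ordinal_sum (ordinal_sum (A, P) (B, Q)) (D, S) \<and>
        (X, L2) = ordinal_sum (ordinal_sum (B, Q) (D, S)) (A, P) \<and>
        (X, L3) = ordinal_sum (ordinal_sum (D, S) (A, P)) (B, Q)"
    by (rule exI[of _ A], rule exI[of _ B], rule exI[of _ D], rule exI[of _ P], rule exI[of _ Q],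
        rule exI[of _ S]) (intro conjI ABD lin sums)
  moreover have "L1 \<noteq> L2" "L2 \<noteq> L3" "L1 \<noteq> L3" using less by auto
  ultimately show ?thesis
    using reg unfolding regular_circ_def mem_Collect_eq prod.case by (intro conjI)
qed

text \<open>Totality holds because initial segments form a chain and, by \<open>rot_code\<close>,
  distinct cuts have distinct codes.\<close>

sublocale completion: unrolled_circular_order "regular_cuts X R" "regular_circ X R" "\<lambda>p q. code p \<subset> code q"
proof
  fix p q r
  show "\<not> code p \<subset> code p" by simp
  show "code p \<subset> code q \<Longrightarrow> code q \<subset> code r \<Longrightarrow> code p \<subset> code r" by (rule psubset_trans)
  show "p = q \<or> code p \<subset> code q \<or> code q \<subset> code p"
    if "p \<in> regular_cuts X R" "q \<in> regular_cuts X R"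
  proof -
    have cut: "is_cut X R p" "is_cut X R q" using that is_cut_regular by auto
    have "p = q" if "code p = code q"
      using arg_cong[OF that, of rot] by (simp only: rot_code[OF cut(1)] rot_code[OF cut(2)])
    then show ?thesis using down_set_chain[OF down_set_code[OF cut(1)] down_set_code[OF cut(2)]] by blast
  qed
  show "(p, q, r) \<in> regular_circ X R \<longleftrightarrow>
    p \<in> regular_cuts X R \<and> q \<in> regular_cuts X R \<and> r \<in> regular_cuts X R \<and>
    (code p \<subset> code q \<and> code q \<subset> code r \<or> code q \<subset> code r \<and> code r \<subset> code p \<or>
     code r \<subset> code p \<and> code p \<subset> code q)" (is "_ \<longleftrightarrow> ?rhs")
  proof
    assume "(p, q, r) \<in> regular_circ X R"
    then obtain A B D P Q S where *: "A \<noteq> {}" "B \<noteq> {}" "D \<noteq> {}"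
      "A \<inter> B = {}" "B \<inter> D = {}" "A \<inter> D = {}" "A \<union> B \<union> D = X"
      "linear_order_on A P" "linear_order_on B Q" "linear_order_on D S"
      "(X, p) = ordinal_sum (ordinal_sum (A, P) (B, Q)) (D, S)"
      "(X, q) = ordinal_sum (ordinal_sum (B, Q) (D, S)) (A, P)"
      "(X, r) = ordinal_sum (ordinal_sum (D, S) (A, P)) (B, Q)"
      "p \<in> regular_cuts X R" "q \<in> regular_cuts X R" "r \<in> regular_cuts X R"
      unfolding regular_circ_def by blast
    \<comment> \<open>The three cuts are rotated so that the block containing \<open>x0\<close>
      comes last.\<close>
    have "B \<inter> A = {}" "D \<inter> B = {}" "D \<inter> A = {}" using * by auto
    then have "x0 \<in> D \<Longrightarrow> code p \<subset> code q \<and> code q \<subset> code r"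
      "x0 \<in> A \<Longrightarrow> code q \<subset> code r \<and> code r \<subset> code p"
      "x0 \<in> B \<Longrightarrow> code r \<subset> code p \<and> code p \<subset> code q"
      using code_psubset_of_ordinal_sums[of A B D P Q S p q r]
        code_psubset_of_ordinal_sums[of B D A Q S P q r p]
        code_psubset_of_ordinal_sums[of D A B S P Q r p q] * by blast+
    then show ?rhs using base * by blast
  next
    assume ?rhs
    then show "(p, q, r) \<in> regular_circ X R"
      using regular_circ_of_code_psubset regular_circ_cyclic by metis
  qed
qed

section \<open>The canonical map\<close>

abbreviation "\<nu> \<equiv> lower_point_cut X R"
abbreviation "Y \<equiv> regular_cuts X R"
abbreviation "C \<equiv> regular_circ X R"

lemma \<nu>_in: "x \<in> X \<Longrightarrow> \<nu> x \<in> Y"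
  by (simp add: regular_cuts_def)

lemma C_distinct: "(p, q, r) \<in> C \<Longrightarrow> p \<noteq> q \<and> q \<noteq> r \<and> p \<noteq> r"
  unfolding completion.mem_C by auto

lemma C_cyclic: "(p, q, r) \<in> C \<Longrightarrow> (q, r, p) \<in> C"
  by (rule regular_circ_cyclic)

lemma C_asym: "(p, q, r) \<in> C \<Longrightarrow> (r, q, p) \<notin> C"
  using circular_order_onD(2)[OF completion.circular_order] .

lemma seg_psubset:
  assumes "x \<in> X" "y \<in> X" "x \<noteq> x0" "y = x0 \<or> x \<sqsubset> y"
  shows "seg x \<subset> seg y"
proof
  show "seg x \<subseteq> seg y"
    using assms by (auto simp: seg_def dest: lt_in_carrier lt_trans)
  have "x \<in> seg y" "x \<notin> seg x" using assms lt_irrefl not_lt_base by (auto simp: seg_def)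
  then show "seg x \<noteq> seg y" by blast
qed

text \<open>Codes increase with the points, except that the least point \<open>x0\<close> has the
  greatest code. A chain starting at \<open>a = x0\<close> therefore becomes \<open>b\<close>,
  \<open>c\<close>, \<open>a\<close>, which is the same triple up to rotation.\<close>

lemma lt_chain_imp_C:
  assumes "a \<sqsubset> b" "b \<sqsubset> c"
  shows "(\<nu> a, \<nu> b, \<nu> c) \<in> C"
proof -
  have X: "a \<in> X" "b \<in> X" "c \<in> X" using assms lt_in_carrier by blast+
  have "b \<noteq> x0" "c \<noteq> x0" using assms not_lt_base by blast+
  then have "seg b \<subset> seg c" "a = x0 \<Longrightarrow> seg c \<subset> seg a" "a \<noteq> x0 \<Longrightarrow> seg a \<subset> seg b"
    using assms seg_psubset X by blast+
  then show ?thesis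
    using X \<nu>_in unfolding completion.mem_C by (cases "a = x0") (simp_all add: code_lower_point_cut)
qed

lemma R_imp_C: "(a, b, c) \<in> R \<Longrightarrow> (\<nu> a, \<nu> b, \<nu> c) \<in> C"
  unfolding unrolled.mem_C using lt_chain_imp_C C_cyclic by blast

lemma C_iff_R:
  assumes X: "a \<in> X" "b \<in> X" "c \<in> X"
  shows "(\<nu> a, \<nu> b, \<nu> c) \<in> C \<longleftrightarrow> (a, b, c) \<in> R"
proof
  assume C: "(\<nu> a, \<nu> b, \<nu> c) \<in> C"
  then have "a \<noteq> b" "b \<noteq> c" "a \<noteq> c" using C_distinct by blast+
  then have "(a, b, c) \<in> R \<or> (a, c, b) \<in> R" using R_total X by blast
  \<comment> \<open>The reversed triple would be carried into \<open>C\<close>, against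
    asymmetry.\<close>
  moreover have "(a, c, b) \<notin> R"
    using R_imp_C[of a c b] C_asym[OF C] C_cyclic[of "\<nu> a" "\<nu> c" "\<nu> b"]
      C_cyclic[of "\<nu> c" "\<nu> b" "\<nu> a"] C_cyclic[of "\<nu> b" "\<nu> a" "\<nu> c"] C_asym[OF C_cyclic[OF C]]
    by blast
  ultimately show "(a, b, c) \<in> R" by blast
qed (rule R_imp_C)

lemma inj_\<nu>: "inj_on \<nu> X"
proof (rule inj_onI)
  fix x y assume X: "x \<in> X" "y \<in> X" and "\<nu> x = \<nu> y"
  then have "seg x = seg y" using code_lower_point_cut by metis
  then show "x = y" using seg_psubset[of x y] seg_psubset[of y x] lt_total[OF X] X by blast
qed

lemma \<nu>_in_closed_arc_iff:
  assumes X: "a \<in> X" "b \<in> X" "x \<in> X"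
  shows "\<nu> x \<in> closed_arc Y C (\<nu> a) (\<nu> b) \<longleftrightarrow> x \<in> closed_arc X R a b"
  using C_iff_R[OF X(1,3,2)] inj_\<nu> X \<nu>_in
  by (auto simp: closed_arc_def open_arc_def dest: inj_onD)

lemma gapD:
  assumes "is_gap X R L"
  shows "code L \<noteq> X" and "u \<in> X \<Longrightarrow> u \<notin> code L \<Longrightarrow> \<exists>v\<in>X. v \<notin> code L \<and> v \<sqsubset> u"
    and "u \<in> code L \<Longrightarrow> \<exists>v\<in>code L. u \<sqsubset> v"
proof -
  have cut: "is_cut X R L" using assms unfolding is_gap_def by (rule conjunct1)
  have *: "code L \<noteq> X \<and> (\<forall>u\<in>X - code L. \<exists>v\<in>X - code L. v \<sqsubset> u) \<and> (\<forall>u\<in>code L. \<exists>v\<in>code L. u \<sqsubset> v)"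
    using is_gap_rot_iff[OF down_set_code[OF cut]] assms unfolding rot_code[OF cut] by (rule iffD1)
  show "code L \<noteq> X" using * by blast
  show "u \<in> X \<Longrightarrow> u \<notin> code L \<Longrightarrow> \<exists>v\<in>X. v \<notin> code L \<and> v \<sqsubset> u" using * by blast
  show "u \<in> code L \<Longrightarrow> \<exists>v\<in>code L. u \<sqsubset> v" using * by blast
qed

lemma seg_psubset_down_set:
  assumes "down_set B" "z \<in> B" "z \<noteq> x0"
  shows "seg z \<subset> B"
  using assms lt_irrefl by (auto simp: seg_def down_set_def)

text \<open>The missing ends of a gap leave room for a point of \<open>X\<close> on the arc from
  \<open>p\<close> to \<open>q\<close>. Exchanging \<open>p\<close> and \<open>q\<close> gives a
  point on the other side.\<close>

lemma point_between:
  assumes Y: "p \<in> Y" "q \<in> Y" and ne: "p \<noteq> q" and gap: "is_gap X R p \<or> is_gap X R q"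
  shows "\<exists>a\<in>X. (p, \<nu> a, q) \<in> C"
proof -
  have down: "down_set (code p)" "down_set (code q)"
    using Y is_cut_regular down_set_code by auto
  have X: "code p \<subseteq> X" "code q \<subseteq> X" by (auto simp: code_def)
  have in_C: "(p, \<nu> a, q) \<in> C"
    if "a \<in> X" "code p \<subset> seg a \<and> seg a \<subset> code q \<or> seg a \<subset> code q \<and> code q \<subset> code p \<or>
      code q \<subset> code p \<and> code p \<subset> seg a" for a
    using that Y \<nu>_in unfolding completion.mem_C by (simp add: code_lower_point_cut)
  consider "code p \<subset> code q" | "code q \<subset> code p" using completion.total[OF Y] ne by blast
  then show ?thesis
  proof cases
    case 1
    then obtain y where y: "y \<in> code q" "y \<notin> code p" by blast
    \<comment> \<open>Here \<open>z\<close> will be the required point, and \<open>y'\<close> makes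
      the inclusion of \<open>code p\<close> in \<open>seg z\<close> strict. If \<open>p\<close> is
      a gap, \<open>y'\<close> can be taken below \<open>y\<close>; if \<open>q\<close> is a gap,
      \<open>z\<close> can be taken above \<open>y\<close>.\<close>
    have "\<exists>z y'. z \<in> code q \<and> y' \<in> X \<and> y' \<notin> code p \<and> y' \<sqsubset> z"
      using gap
    proof
      assume "is_gap X R p"
      then obtain v where "v \<in> X" "v \<notin> code p" "v \<sqsubset> y" using gapD(2)[of p y] y X by blast
      then show ?thesis using y by blast
    next
      assume "is_gap X R q"
      then obtain v where "v \<in> code q" "y \<sqsubset> v" using gapD(3)[of q y] y by blast
      then show ?thesis using y X by blast
    qed
    then obtain z y' where z: "z \<in> code q" "y' \<in> X" "y' \<notin> code p" "y' \<sqsubset> z" by blast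
    have "z \<noteq> x0" using z not_lt_base by blast
    then have "seg z \<subset> code q" using seg_psubset_down_set down z by blast
    moreover have "z \<notin> code p" using z down(1) unfolding down_set_def by blast
    then have "code p \<subseteq> seg z" using down_set_lt[OF down(1)] z X \<open>z \<noteq> x0\<close> by (auto simp: seg_def)
    moreover have "y' \<in> seg z" using z \<open>z \<noteq> x0\<close> by (simp add: seg_def)
    ultimately show ?thesis using in_C[of z] z X by blast
  next
    case 2
    \<comment> \<open>The arc from \<open>p\<close> to \<open>q\<close> now wraps around, so the
      point may have a code above that of \<open>p\<close>, for which \<open>x0\<close> with code
      \<open>X\<close> serves, or one below that of \<open>q\<close>.\<close>
    show ?thesis
      using gap
    proof
      assume "is_gap X R p"
      then have "code p \<subset> seg x0" using gapD(1) X by (auto simp: seg_def)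
      then show ?thesis using in_C[of x0] 2 base by blast
    next
      assume "is_gap X R q"
      moreover have "x0 \<in> code q" using down(2) unfolding down_set_def by blast
      ultimately obtain z where z: "z \<in> code q" "x0 \<sqsubset> z" using gapD(3)[of q x0] by blast
      then have "z \<noteq> x0" using lt_irrefl by blast
      then have "seg z \<subset> code q" using seg_psubset_down_set[OF down(2) z(1)] by blast
      then show ?thesis using in_C[of z] 2 z X by blast
    qed
  qed
qed

section \<open>Topology of the canonical map\<close>

lemma regular_cut_cases:
  assumes "L \<in> Y"
  obtains "is_gap X R L" | x where "x \<in> X" "L = \<nu> x"
  using assms unfolding regular_cuts_def by blast

text \<open>An arc avoiding \<open>\<nu> x\<close> is enlarged to one with point cuts as ends: an
  end that is a gap is moved towards \<open>\<nu> x\<close> by \<open>point_between\<close>. The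
  larger arc still avoids \<open>\<nu> x\<close> and corresponds to an arc of
  \<open>X\<close>.\<close>

lemma continuous_\<nu>: "continuous_map (interval_topology X R) (interval_topology Y C) \<nu>"
proof -
  have "openin (interval_topology X R) {x \<in> X. \<nu> x \<in> V}" if V: "openin (interval_topology Y C) V" for V
    unfolding openin_interval_topology_pointwise[OF circular]
  proof (intro conjI ballI)
    fix x assume "x \<in> {x \<in> X. \<nu> x \<in> V}"
    then have x: "x \<in> X" "\<nu> x \<in> V" by auto
    show "{x \<in> X. \<nu> x \<in> V} = X \<or> (\<exists>a\<in>X. \<exists>b\<in>X. x \<notin> closed_arc X R a b \<and>
        X - closed_arc X R a b \<subseteq> {x \<in> X. \<nu> x \<in> V})"
    proof (cases "V = Y")
      case True
      then show ?thesis using \<nu>_in by auto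
    next
      case False
      then obtain p q where pq: "p \<in> Y" "q \<in> Y" "\<nu> x \<notin> closed_arc Y C p q" "Y - closed_arc Y C p q \<subseteq> V"
        using V x(2) openin_interval_topology_pointwise[OF completion.circular_order] by meson
      have ne: "\<nu> x \<noteq> p" "q \<noteq> \<nu> x" using pq(3) by (auto simp: closed_arc_def)
      have "\<exists>a\<in>X. \<nu> a = p \<or> (\<nu> x, \<nu> a, p) \<in> C"
        using point_between[OF \<nu>_in[OF x(1)] pq(1) ne(1)] by (cases rule: regular_cut_cases[OF pq(1)]) blast+
      then obtain a where a: "a \<in> X" "\<nu> a = p \<or> (\<nu> x, \<nu> a, p) \<in> C" by blast
      have "\<exists>b\<in>X. \<nu> b = q \<or> (q, \<nu> b, \<nu> x) \<in> C"
        using point_between[OF pq(2) \<nu>_in[OF x(1)] ne(2)] by (cases rule: regular_cut_cases[OF pq(2)]) blast+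
      then obtain b where b: "b \<in> X" "\<nu> b = q \<or> (q, \<nu> b, \<nu> x) \<in> C" by blast
      then have b': "\<nu> b = q \<or> (\<nu> x, q, \<nu> b) \<in> C" using C_cyclic by blast
      note arc = closed_arc_mono_outside[OF completion.circular_order \<nu>_in[OF x(1)] pq(1,2)
          \<nu>_in[OF a(1)] \<nu>_in[OF b(1)] pq(3) a(2) b']
      have "x \<notin> closed_arc X R a b" using arc(1) \<nu>_in_closed_arc_iff[OF a(1) b(1) x(1)] by simp
      moreover have "\<nu> y \<in> V" if "y \<in> X" "y \<notin> closed_arc X R a b" for y
        using that arc(2) \<nu>_in_closed_arc_iff[OF a(1) b(1) that(1)] pq(4) \<nu>_in by blast
      ultimately show ?thesis using a(1) b(1) by blast
    qed
  qed auto
  then show ?thesis unfolding continuous_map_def using \<nu>_in by auto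
qed

text \<open>For ends in \<open>X\<close>, the trace on the image of \<open>\<nu>\<close> of the
  complement of an arc is the image of the corresponding complement in \<open>X\<close>. Hence
  \<open>\<nu>\<close> is open onto its image.\<close>

lemma embedding_\<nu>: "embedding_map (interval_topology X R) (interval_topology Y C) \<nu>"
proof -
  let ?S = "subtopology (interval_topology Y C) (\<nu> ` X)"
  have img: "topspace ?S = \<nu> ` X" using \<nu>_in by auto
  have "openin ?S (\<nu> ` U)" if U: "openin (interval_topology X R) U" for U
  proof (subst openin_subopen, intro ballI)
    fix y assume "y \<in> \<nu> ` U"
    then obtain x where x: "x \<in> U" "y = \<nu> x" by blast
    have UX: "U \<subseteq> X" using openin_subset[OF U] by simp
    show "\<exists>T. openin ?S T \<and> y \<in> T \<and> T \<subseteq> \<nu> ` U"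
    proof (cases "U = X")
      case True
      then show ?thesis using x img by (metis image_eqI openin_topspace subset_refl)
    next
      case False
      then obtain a b where ab: "a \<in> X" "b \<in> X" "x \<notin> closed_arc X R a b" "X - closed_arc X R a b \<subseteq> U"
        using U x openin_interval_topology_pointwise[OF circular] by meson
      let ?T = "Y - closed_arc Y C (\<nu> a) (\<nu> b)"
      have "openin (interval_topology Y C) ?T"
        unfolding interval_topology_def using ab(1,2) \<nu>_in
        by (intro topology_generated_by_Basis) (auto simp: interval_base_def)
      then have "openin ?S (\<nu> ` X \<inter> ?T)" by (rule openin_subtopology_Int2)
      moreover have "y \<in> \<nu> ` X \<inter> ?T" using x UX ab \<nu>_in \<nu>_in_closed_arc_iff[OF ab(1,2)] by blast
      moreover have "\<nu> ` X \<inter> ?T \<subseteq> \<nu> ` U" using \<nu>_in_closed_arc_iff[OF ab(1,2)] ab(4) by blast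
      ultimately show ?thesis by blast
    qed
  qed
  then have "open_map (interval_topology X R) ?S \<nu>" unfolding open_map_def by blast
  moreover have "continuous_map (interval_topology X R) ?S \<nu>"
    using continuous_\<nu> by (auto simp: continuous_map_in_subtopology)
  ultimately show ?thesis
    unfolding embedding_map_def topspace_interval_topology
    by (intro bijective_open_imp_homeomorphic_map) (use img inj_\<nu> in auto)
qed

lemma dense_\<nu>: "interval_topology Y C closure_of (\<nu> ` X) = Y"
proof -
  have "\<exists>y\<in>\<nu> ` X. y \<in> T" if g: "g \<in> Y" "g \<in> T" and T: "openin (interval_topology Y C) T" for g T
    using g(1)
  proof (cases rule: regular_cut_cases)
    case 1
    show ?thesis
    proof (cases "T = Y")
      case True
      then show ?thesis using \<nu>_in base by blast
    next
      case False
      then obtain p q where pq: "p \<in> Y" "q \<in> Y" "g \<notin> closed_arc Y C p q" "Y - closed_arc Y C p q \<subseteq> T"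
        using T g(2) openin_interval_topology_pointwise[OF completion.circular_order] by meson
      have "g \<noteq> p" using pq by (auto simp: closed_arc_def)
      then obtain a where a: "a \<in> X" "(g, \<nu> a, p) \<in> C" using point_between[OF g(1) pq(1)] 1 by blast
      \<comment> \<open>Seen from \<open>g\<close>, the cut \<open>\<nu> a\<close> comes before
        \<open>p\<close>, hence before the whole arc from \<open>p\<close> to
        \<open>q\<close>.\<close>
      have "(g, p, \<nu> a) \<notin> C" using C_asym[OF C_cyclic[OF C_cyclic[OF a(2)]]] C_cyclic by blast
      then have "\<nu> a \<notin> closed_arc Y C p q"
        using C_distinct[OF a(2)] closed_arc_from_outside(2)[OF completion.circular_order g(1) pq(1-3)]
        by auto
      then show ?thesis using pq(4) a(1) \<nu>_in by blast
    qed
  qed (use g in blast)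
  then show ?thesis by (auto simp: in_closure_of)
qed

text \<open>A code containing a greatest point of the union is already the whole union. Otherwise a
  least point of the complement, or \<open>x0\<close> if the union is \<open>X\<close>, has the
  union as its \<open>seg\<close>; with no such point the rotation lacks both ends and is a
  gap.\<close>

lemma ex_regular_cut_Union:
  assumes "S \<subseteq> Y" "S \<noteq> {}"
  shows "\<exists>s\<in>Y. code s = (\<Union>p\<in>S. code p)"
proof -
  define U where "U = (\<Union>p\<in>S. code p)"
  have down: "down_set (code p)" if "p \<in> S" for p
    using that assms(1) is_cut_regular down_set_code by blast
  have U: "down_set U"
    using down assms(2) unfolding U_def down_set_def by blast
  have "\<exists>s\<in>Y. code s = U"
  proof (cases "\<exists>u\<in>U. \<forall>v\<in>U. \<not> u \<sqsubset> v")
    case True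
    then obtain u p where u: "\<forall>v\<in>U. \<not> u \<sqsubset> v" and p: "p \<in> S" "u \<in> code p" unfolding U_def by blast
    have "U \<subseteq> code p"
      using down_set_lt[OF down[OF p(1)] p(2)] u U unfolding down_set_def by blast
    then have "code p = U" using p(1) unfolding U_def by blast
    then show ?thesis using p(1) assms(1) by blast
  next
    case no_max: False
    show ?thesis
    proof (cases "U = X \<or> (\<exists>u\<in>X - U. \<forall>v\<in>X - U. \<not> v \<sqsubset> u)")
      case True
      then have "\<exists>x\<in>X. seg x = U"
      proof
        assume "\<exists>u\<in>X - U. \<forall>v\<in>X - U. \<not> v \<sqsubset> u"
        then obtain u where u: "u \<in> X" "u \<notin> U" "\<forall>v\<in>X - U. \<not> v \<sqsubset> u" by blast
        have "u \<noteq> x0" using u U unfolding down_set_def by blast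
        then have "seg u = U"
          using u down_set_lt[OF U _ u(1,2)] lt_in_carrier by (auto simp: seg_def)
        then show ?thesis using u by blast
      qed (use base in \<open>auto simp: seg_def\<close>)
      then show ?thesis using code_lower_point_cut \<nu>_in by blast
    next
      case False
      then have "is_gap X R (rot U)" unfolding is_gap_rot_iff[OF U] using no_max by blast
      then show ?thesis using code_rot[OF U] unfolding regular_cuts_def by blast
    qed
  qed
  then show ?thesis unfolding U_def .
qed

lemma compact_completion: "compact_space (interval_topology Y C)"
proof (rule completion.compact)
  show "\<nu> x0 \<in> Y" using \<nu>_in base .
  show "\<not> code (\<nu> x0) \<subset> code y" for y
    using code_lower_point_cut[OF base] by (auto simp: seg_def code_def)
  fix S assume S: "S \<subseteq> Y" "S \<noteq> {}"
  then obtain s where s: "s \<in> Y" "code s = (\<Union>p\<in>S. code p)" using ex_regular_cut_Union by blast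
  have "\<not> code s \<subset> code p" if "p \<in> S" for p using that s(2) by blast
  moreover have "\<exists>p\<in>S. code c \<subset> code p" if c: "c \<in> Y" "code c \<subset> code s" for c
  proof -
    \<comment> \<open>A point of the union outside \<open>code c\<close> lies in some
      \<open>code p\<close>, which strictly contains \<open>code c\<close> because codes form a
      chain.\<close>
    obtain z p where z: "z \<in> code p" "z \<notin> code c" "p \<in> S" using c(2) s(2) by blast
    moreover have "code p \<subseteq> code c \<or> code c \<subseteq> code p"
      using down_set_chain down_set_code is_cut_regular c(1) z(3) S(1) by blast
    ultimately show ?thesis by blast
  qed
  ultimately show "\<exists>s\<in>Y. (\<forall>p\<in>S. \<not> code s \<subset> code p) \<and> (\<forall>c\<in>Y. code c \<subset> code s \<longrightarrow> (\<exists>p\<in>S. code c \<subset> code p))"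
    using s(1) by blast
qed

lemma cop_\<nu>: "cop X R Y C \<nu>"
proof -
  have "\<nu> constant_on closed_arc X R x y" if "x \<in> X" "y \<in> X" "\<nu> x = \<nu> y" for x y
  proof -
    \<comment> \<open>By injectivity the arc in the second COP condition is a single point.\<close>
    have "x = y" using inj_\<nu> that by (auto dest: inj_onD)
    then have "closed_arc X R x y = {x}" using R_distinct by (auto simp: closed_arc_def open_arc_def)
    then show ?thesis by (auto simp: constant_on_def)
  qed
  then show ?thesis unfolding cop_def using \<nu>_in R_imp_C by blast
qed

end

theorem theorem8p4:
  fixes X :: "'a set" and R :: "('a \<times> 'a \<times> 'a) set"
  assumes "circular_order_on X R" and "X \<noteq> {}"
  shows "cop X R (regular_cuts X R) (regular_circ X R) (lower_point_cut X R) \<and>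
    embedding_map (interval_topology X R)
      (interval_topology (regular_cuts X R) (regular_circ X R)) (lower_point_cut X R) \<and>
    interval_topology (regular_cuts X R) (regular_circ X R) closure_of (lower_point_cut X R ` X)
      = regular_cuts X R \<and>
    circular_order_on (regular_cuts X R) (regular_circ X R) \<and>
    compact_space (interval_topology (regular_cuts X R) (regular_circ X R))"
proof -
  obtain x0 where "x0 \<in> X" using assms(2) by blast
  then interpret pointed_circular_order X R x0
    using assms(1) by unfold_locales
  show ?thesis
    using cop_\<nu> embedding_\<nu> dense_\<nu> completion.circular_order compact_completion by (intro conjI)
qed

end
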